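(* The following data form a bicategory $\mathbf{B}$. Objects are groupoids. For groupoids $H,G$, $\mathbf{B}(H,G)$ is the groupoid of admissible $(H,G)$-bi-sets and natural isomorphisms. Composition $\mathbf{B}(H,G)\times\mathbf{B}(K,H)\to\mathbf{B}(K,G)$ sends $(X,Y)$ to $X\otimes_HY$, where $(X\otimes_HY)^\kappa_\gamma=X_\gamma\otimes_HY^\kappa$ (in particular, $X\otimes_HY$ is again admissible). The identity of $G$ is $(1_G)^{\gamma'}_\gamma=G(\gamma',\gamma)$. The unitors $\rho:X\otimes_G1_G\to X$ and $\lambda:1_G\otimes_GY\to Y$ are the isomorphisms induced by the actions, $[x,g]\mapsto xg$ and $[g,y]\mapsto gy$, and the associator $X\otimes_G(Y\otimes_HZ)\to(X\otimes_GY)\otimes_HZ$ is $[x,[y,z]]\mapsto[[x,y],z]$.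
   Context: All groupoids are small; $G_0$ is the object set of $G$. A (left) $G$-set is a functor $X:G\to\mathbf{Set}$, with values $X_\gamma$; for $g:\gamma'\to\gamma$ and $x\in X_{\gamma'}$ write $gx\in X_\gamma$. A right $G$-set is a functor $Y:G^{\mathrm{op}}\to\mathbf{Set}$, with values $Y^\gamma$ and action $y\mapsto yg$. A $G$-set $X$ is free if for all $\gamma,\gamma'\in G_0$ and $x\in X_{\gamma'}$ the map $G(\gamma',\gamma)\to X_\gamma$, $g\mapsto gx$, is injective; it is finitely generated if $\mathrm{colim}_GX$ is finite. An $(H,G)$-bi-set is a functor $X:H^{\mathrm{op}}\times G\to\mathbf{Set}$, with values $X^\eta_\gamma$; it is admissible if for every $\eta\in H_0$ the $G$-set $X^\eta$ is free and finitely generated. For a right $H$-set $X$ and left $H$-set $Y$, the co-end is $X\otimes_HY=\coprod_{\eta\in H_0}X^\eta\times Y_\eta/\sim$, with $(xh,y)\sim(x,hy)$; $[x,y]$ is the class of $(x,y)$. *)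

theory Defs
  imports "HOL-Library.FuncSet" "HOL-Library.Infinite_Typeclass"
begin

section \<open>Categories, functors, natural isomorphisms\<close>

record ('o, 'a) category =
  Obj :: "'o set"
  Arr :: "'a set"
  Dom :: "'a \<Rightarrow> 'o"
  Cod :: "'a \<Rightarrow> 'o"
  Ide :: "'o \<Rightarrow> 'a"
  Comp :: "'a \<Rightarrow> 'a \<Rightarrow> 'a"

text \<open>\<open>Comp C g f\<close> is the composite of \<open>f\<close> followed by \<open>g\<close>.\<close>

definition hom :: "('o, 'a) category \<Rightarrow> 'o \<Rightarrow> 'o \<Rightarrow> 'a set" where
  "hom C x y = {f \<in> Arr C. Dom C f = x \<and> Cod C f = y}"

locale category =
  fixes C :: "('o, 'a) category"
  assumes Dom_in: "f \<in> Arr C \<Longrightarrow> Dom C f \<in> Obj C"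
    and Cod_in: "f \<in> Arr C \<Longrightarrow> Cod C f \<in> Obj C"
    and Ide_in: "x \<in> Obj C \<Longrightarrow> Ide C x \<in> hom C x x"
    and Comp_in: "f \<in> hom C x y \<Longrightarrow> g \<in> hom C y z \<Longrightarrow> Comp C g f \<in> hom C x z"
    and Comp_Ide: "f \<in> hom C x y \<Longrightarrow> Comp C f (Ide C x) = f"
    and Ide_Comp: "f \<in> hom C x y \<Longrightarrow> Comp C (Ide C y) f = f"
    and Comp_assoc: "f \<in> hom C w x \<Longrightarrow> g \<in> hom C x y \<Longrightarrow> h \<in> hom C y z \<Longrightarrow>
      Comp C h (Comp C g f) = Comp C (Comp C h g) f"

definition is_iso :: "('o, 'a) category \<Rightarrow> 'o \<Rightarrow> 'o \<Rightarrow> 'a \<Rightarrow> bool" where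
  "is_iso C x y f \<longleftrightarrow> f \<in> hom C x y \<and>
     (\<exists>g \<in> hom C y x. Comp C g f = Ide C x \<and> Comp C f g = Ide C y)"

locale groupoid = category +
  assumes all_iso: "f \<in> Arr C \<Longrightarrow> is_iso C (Dom C f) (Cod C f) f"

text \<open>The structure maps of a record are total functions. Fixing their values outside the
  relevant domains makes equality of records agree with equality of categories.\<close>

definition extensional_category :: "('o, 'a) category \<Rightarrow> bool" where
  "extensional_category C \<longleftrightarrow>
     Dom C \<in> extensional (Arr C) \<and> Cod C \<in> extensional (Arr C) \<and> Ide C \<in> extensional (Obj C) \<and>
     (\<forall>g f. \<not> (f \<in> Arr C \<and> g \<in> Arr C \<and> Cod C f = Dom C g) \<longrightarrow> Comp C g f = undefined)"

definition op_cat :: "('o, 'a) category \<Rightarrow> ('o, 'a) category" where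
  "op_cat C = \<lparr>Obj = Obj C, Arr = Arr C, Dom = Cod C, Cod = Dom C, Ide = Ide C,
     Comp = (\<lambda>g f. Comp C f g)\<rparr>"

definition prod_cat ::
    "('o, 'a) category \<Rightarrow> ('p, 'b) category \<Rightarrow> ('o \<times> 'p, 'a \<times> 'b) category" where
  "prod_cat C D = \<lparr>Obj = Obj C \<times> Obj D, Arr = Arr C \<times> Arr D,
     Dom = map_prod (Dom C) (Dom D), Cod = map_prod (Cod C) (Cod D),
     Ide = map_prod (Ide C) (Ide D),
     Comp = (\<lambda>(g, g') (f, f'). (Comp C g f, Comp D g' f'))\<rparr>"

record ('o, 'a, 'p, 'b) functor_data =
  Fobj :: "'o \<Rightarrow> 'p"
  Farr :: "'a \<Rightarrow> 'b"

definition is_functor ::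
    "('o, 'a) category \<Rightarrow> ('p, 'b) category \<Rightarrow> ('o, 'a, 'p, 'b) functor_data \<Rightarrow> bool" where
  "is_functor C D F \<longleftrightarrow>
     Fobj F \<in> Obj C \<rightarrow>\<^sub>E Obj D \<and> Farr F \<in> Arr C \<rightarrow>\<^sub>E Arr D \<and>
     (\<forall>f \<in> Arr C. Dom D (Farr F f) = Fobj F (Dom C f) \<and> Cod D (Farr F f) = Fobj F (Cod C f)) \<and>
     (\<forall>x \<in> Obj C. Farr F (Ide C x) = Ide D (Fobj F x)) \<and>
     (\<forall>f \<in> Arr C. \<forall>g \<in> Arr C. Cod C f = Dom C g \<longrightarrow>
        Farr F (Comp C g f) = Comp D (Farr F g) (Farr F f))"

definition nat_iso ::
    "('o, 'a) category \<Rightarrow> ('p, 'b) category \<Rightarrow> ('o, 'a, 'p, 'b) functor_data \<Rightarrow>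
     ('o, 'a, 'p, 'b) functor_data \<Rightarrow> ('o \<Rightarrow> 'b) \<Rightarrow> bool" where
  "nat_iso C D F F' t \<longleftrightarrow>
     t \<in> extensional (Obj C) \<and>
     (\<forall>x \<in> Obj C. is_iso D (Fobj F x) (Fobj F' x) (t x)) \<and>
     (\<forall>f \<in> Arr C. Comp D (t (Cod C f)) (Farr F f) = Comp D (Farr F' f) (t (Dom C f)))"

text \<open>A map or a natural transformation packaged with its source and target.\<close>

datatype ('o, 'f) arrow = Arrow (src: 'o) (amap: 'f) (trg: 'o)

type_synonym 'u set_map = "('u set, 'u \<Rightarrow> 'u) arrow"

definition set_cat :: "('u set, 'u set_map) category" where
  "set_cat = \<lparr>Obj = UNIV, Arr = {f. amap f \<in> src f \<rightarrow>\<^sub>E trg f}, Dom = src, Cod = trg,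
     Ide = (\<lambda>A. Arrow A (\<lambda>x\<in>A. x) A),
     Comp = (\<lambda>g f. Arrow (src f) (compose (src f) (amap g) (amap f)) (trg g))\<rparr>"


section \<open>Bicategories\<close>

text \<open>\<open>Hom B H G\<close> is the category of 1-cells from \<open>H\<close> to \<open>G\<close>; \<open>HComp B K H G\<close> is horizontal
  composition, with arguments in applicative order, \<open>(X, Y) \<mapsto> X Y\<close>, where \<open>X\<close> goes from \<open>H\<close> to
  \<open>G\<close> and \<open>Y\<close> from \<open>K\<close> to \<open>H\<close>.\<close>

record ('b, 'o, 'a) bicategory_data =
  Ob0 :: "'b set"
  Hom :: "'b \<Rightarrow> 'b \<Rightarrow> ('o, 'a) category"
  HComp :: "'b \<Rightarrow> 'b \<Rightarrow> 'b \<Rightarrow> ('o \<times> 'o, 'a \<times> 'a, 'o, 'a) functor_data"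
  Unit :: "'b \<Rightarrow> 'o"
  Assoc :: "'b \<Rightarrow> 'b \<Rightarrow> 'b \<Rightarrow> 'b \<Rightarrow> 'o \<Rightarrow> 'o \<Rightarrow> 'o \<Rightarrow> 'a"
  RUnit :: "'b \<Rightarrow> 'b \<Rightarrow> 'o \<Rightarrow> 'a"
  LUnit :: "'b \<Rightarrow> 'b \<Rightarrow> 'o \<Rightarrow> 'a"

abbreviation hcomp1 ::
    "('b, 'o, 'a) bicategory_data \<Rightarrow> 'b \<Rightarrow> 'b \<Rightarrow> 'b \<Rightarrow> 'o \<Rightarrow> 'o \<Rightarrow> 'o" where
  "hcomp1 B K H G X Y \<equiv> Fobj (HComp B K H G) (X, Y)"

abbreviation hcomp2 ::
    "('b, 'o, 'a) bicategory_data \<Rightarrow> 'b \<Rightarrow> 'b \<Rightarrow> 'b \<Rightarrow> 'a \<Rightarrow> 'a \<Rightarrow> 'a" where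
  "hcomp2 B K H G a b \<equiv> Farr (HComp B K H G) (a, b)"

locale bicategory =
  fixes B :: "('b, 'o, 'a) bicategory_data"
  assumes Hom_category:
    "\<lbrakk>H \<in> Ob0 B; G \<in> Ob0 B\<rbrakk> \<Longrightarrow> category (Hom B H G)"
  and HComp_functor:
    "\<lbrakk>K \<in> Ob0 B; H \<in> Ob0 B; G \<in> Ob0 B\<rbrakk> \<Longrightarrow>
      is_functor (prod_cat (Hom B H G) (Hom B K H)) (Hom B K G) (HComp B K H G)"
  and Unit_in:
    "G \<in> Ob0 B \<Longrightarrow> Unit B G \<in> Obj (Hom B G G)"
  and Assoc_iso:
    "\<lbrakk>K \<in> Ob0 B; H \<in> Ob0 B; G \<in> Ob0 B; L \<in> Ob0 B;
      X \<in> Obj (Hom B G L); Y \<in> Obj (Hom B H G); Z \<in> Obj (Hom B K H)\<rbrakk> \<Longrightarrow>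
      is_iso (Hom B K L)
        (hcomp1 B K G L X (hcomp1 B K H G Y Z)) (hcomp1 B K H L (hcomp1 B H G L X Y) Z)
        (Assoc B K H G L X Y Z)"
  and Assoc_natural:
    "\<lbrakk>K \<in> Ob0 B; H \<in> Ob0 B; G \<in> Ob0 B; L \<in> Ob0 B;
      a \<in> hom (Hom B G L) X X'; b \<in> hom (Hom B H G) Y Y'; c \<in> hom (Hom B K H) Z Z'\<rbrakk> \<Longrightarrow>
      Comp (Hom B K L) (Assoc B K H G L X' Y' Z') (hcomp2 B K G L a (hcomp2 B K H G b c)) =
      Comp (Hom B K L) (hcomp2 B K H L (hcomp2 B H G L a b) c) (Assoc B K H G L X Y Z)"
  and RUnit_iso:
    "\<lbrakk>H \<in> Ob0 B; G \<in> Ob0 B; X \<in> Obj (Hom B H G)\<rbrakk> \<Longrightarrow>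
      is_iso (Hom B H G) (hcomp1 B H H G X (Unit B H)) X (RUnit B H G X)"
  and RUnit_natural:
    "\<lbrakk>H \<in> Ob0 B; G \<in> Ob0 B; a \<in> hom (Hom B H G) X X'\<rbrakk> \<Longrightarrow>
      Comp (Hom B H G) (RUnit B H G X') (hcomp2 B H H G a (Ide (Hom B H H) (Unit B H))) =
      Comp (Hom B H G) a (RUnit B H G X)"
  and LUnit_iso:
    "\<lbrakk>H \<in> Ob0 B; G \<in> Ob0 B; X \<in> Obj (Hom B H G)\<rbrakk> \<Longrightarrow>
      is_iso (Hom B H G) (hcomp1 B H G G (Unit B G) X) X (LUnit B H G X)"
  and LUnit_natural:
    "\<lbrakk>H \<in> Ob0 B; G \<in> Ob0 B; a \<in> hom (Hom B H G) X X'\<rbrakk> \<Longrightarrow>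
      Comp (Hom B H G) (LUnit B H G X') (hcomp2 B H G G (Ide (Hom B G G) (Unit B G)) a) =
      Comp (Hom B H G) a (LUnit B H G X)"
  and pentagon:
    "\<lbrakk>J \<in> Ob0 B; K \<in> Ob0 B; H \<in> Ob0 B; G \<in> Ob0 B; L \<in> Ob0 B;
      W \<in> Obj (Hom B G L); X \<in> Obj (Hom B H G); Y \<in> Obj (Hom B K H); Z \<in> Obj (Hom B J K)\<rbrakk> \<Longrightarrow>
      Comp (Hom B J L)
        (Assoc B J K H L (hcomp1 B H G L W X) Y Z)
        (Assoc B J H G L W X (hcomp1 B J K H Y Z)) =
      Comp (Hom B J L)
        (hcomp2 B J K L (Assoc B K H G L W X Y) (Ide (Hom B J K) Z))
        (Comp (Hom B J L)
          (Assoc B J K G L W (hcomp1 B K H G X Y) Z)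
          (hcomp2 B J G L (Ide (Hom B G L) W) (Assoc B J K H G X Y Z)))"
  and triangle:
    "\<lbrakk>K \<in> Ob0 B; H \<in> Ob0 B; G \<in> Ob0 B; X \<in> Obj (Hom B H G); Y \<in> Obj (Hom B K H)\<rbrakk> \<Longrightarrow>
      Comp (Hom B K G)
        (hcomp2 B K H G (RUnit B H G X) (Ide (Hom B K H) Y))
        (Assoc B K H H G X (Unit B H) Y) =
      hcomp2 B K H G (Ide (Hom B H G) X) (LUnit B K H Y)"


section \<open>Sets and bi-sets over groupoids\<close>

text \<open>Small sets are the subsets of an arbitrary infinite type \<open>'u\<close>, and small groupoids have
  their objects and arrows in \<open>'u\<close>. A left \<open>G\<close>-set is a functor \<open>G \<rightarrow> set_cat\<close>, a right \<open>G\<close>-set is a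
  functor \<open>op_cat G \<rightarrow> set_cat\<close>.\<close>

type_synonym 'u gpd = "('u, 'u) category"
type_synonym 'u gset = "('u, 'u, 'u set, 'u set_map) functor_data"
type_synonym 'u biset = "('u \<times> 'u, 'u \<times> 'u, 'u set, 'u set_map) functor_data"
type_synonym 'u biset_map = "('u biset, 'u \<times> 'u \<Rightarrow> 'u set_map) arrow"

definition small_groupoids :: "'u gpd set" where
  "small_groupoids = {G. groupoid G \<and> extensional_category G}"

text \<open>For a left \<open>G\<close>-set, \<open>act X g x\<close> is \<open>gx\<close>; for a right \<open>G\<close>-set, it is \<open>xg\<close>.\<close>

definition act :: "('o, 'a, 'u set, 'u set_map) functor_data \<Rightarrow> 'a \<Rightarrow> 'u \<Rightarrow> 'u" where
  "act X g x = amap (Farr X g) x"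

definition free_gset :: "'u gpd \<Rightarrow> 'u gset \<Rightarrow> bool" where
  "free_gset G X \<longleftrightarrow>
     (\<forall>\<gamma> \<in> Obj G. \<forall>\<gamma>' \<in> Obj G. \<forall>x \<in> Fobj X \<gamma>'. inj_on (\<lambda>g. act X g x) (hom G \<gamma>' \<gamma>))"

definition colim_step :: "'u gpd \<Rightarrow> 'u gset \<Rightarrow> 'u \<times> 'u \<Rightarrow> 'u \<times> 'u \<Rightarrow> bool" where
  "colim_step G X p q \<longleftrightarrow>
     (\<exists>g \<in> Arr G. \<exists>x \<in> Fobj X (Dom G g). p = (Dom G g, x) \<and> q = (Cod G g, act X g x))"

definition colim :: "'u gpd \<Rightarrow> 'u gset \<Rightarrow> ('u \<times> 'u) set set" where
  "colim G X = (SIGMA \<gamma> : Obj G. Fobj X \<gamma>) // {(p, q). equivclp (colim_step G X) p q}"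

definition finitely_generated :: "'u gpd \<Rightarrow> 'u gset \<Rightarrow> bool" where
  "finitely_generated G X \<longleftrightarrow> finite (colim G X)"

definition bi_cat :: "'u gpd \<Rightarrow> 'u gpd \<Rightarrow> ('u \<times> 'u, 'u \<times> 'u) category" where
  "bi_cat H G = prod_cat (op_cat H) G"

text \<open>For an \<open>(H, G)\<close>-bi-set \<open>X\<close>, \<open>fix_upper H G X \<eta>\<close> is the left \<open>G\<close>-set with values
  \<open>Fobj X (\<eta>, \<gamma>)\<close>, and \<open>fix_lower H G X \<gamma>\<close> is the right \<open>H\<close>-set with values \<open>Fobj X (\<eta>, \<gamma>)\<close>.\<close>

definition fix_upper :: "'u gpd \<Rightarrow> 'u gpd \<Rightarrow> 'u biset \<Rightarrow> 'u \<Rightarrow> 'u gset" where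
  "fix_upper H G X \<eta> = \<lparr>Fobj = (\<lambda>\<gamma>\<in>Obj G. Fobj X (\<eta>, \<gamma>)),
     Farr = (\<lambda>g\<in>Arr G. Farr X (Ide H \<eta>, g))\<rparr>"

definition fix_lower :: "'u gpd \<Rightarrow> 'u gpd \<Rightarrow> 'u biset \<Rightarrow> 'u \<Rightarrow> 'u gset" where
  "fix_lower H G X \<gamma> = \<lparr>Fobj = (\<lambda>\<eta>\<in>Obj H. Fobj X (\<eta>, \<gamma>)),
     Farr = (\<lambda>h\<in>Arr H. Farr X (h, Ide G \<gamma>))\<rparr>"

definition is_biset :: "'u gpd \<Rightarrow> 'u gpd \<Rightarrow> 'u biset \<Rightarrow> bool" where
  "is_biset H G X \<longleftrightarrow> is_functor (bi_cat H G) set_cat X"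

definition admissible :: "'u gpd \<Rightarrow> 'u gpd \<Rightarrow> 'u biset \<Rightarrow> bool" where
  "admissible H G X \<longleftrightarrow> is_biset H G X \<and>
     (\<forall>\<eta> \<in> Obj H. free_gset G (fix_upper H G X \<eta>) \<and> finitely_generated G (fix_upper H G X \<eta>))"

definition biset_cat :: "'u gpd \<Rightarrow> 'u gpd \<Rightarrow> ('u biset, 'u biset_map) category" where
  "biset_cat H G = \<lparr>Obj = {X. admissible H G X},
     Arr = {a. admissible H G (src a) \<and> admissible H G (trg a) \<and>
               nat_iso (bi_cat H G) set_cat (src a) (trg a) (amap a)},
     Dom = src, Cod = trg,
     Ide = (\<lambda>X. Arrow X (\<lambda>p\<in>Obj (bi_cat H G). Ide set_cat (Fobj X p)) X),
     Comp = (\<lambda>b a. Arrow (src a)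
               (\<lambda>p\<in>Obj (bi_cat H G). Comp set_cat (amap b p) (amap a p)) (trg b))\<rparr>"


section \<open>Co-ends\<close>

text \<open>The coproduct of the sets \<open>X\<^sup>\<eta> \<times> Y\<^sub>\<eta>\<close> consists of triples \<open>(\<eta>, x, y)\<close>.\<close>

definition coend_triples :: "'u gpd \<Rightarrow> 'u gset \<Rightarrow> 'u gset \<Rightarrow> ('u \<times> 'u \<times> 'u) set" where
  "coend_triples H X Y = (SIGMA \<eta> : Obj H. Fobj X \<eta> \<times> Fobj Y \<eta>)"

definition coend_step ::
    "'u gpd \<Rightarrow> 'u gset \<Rightarrow> 'u gset \<Rightarrow> 'u \<times> 'u \<times> 'u \<Rightarrow> 'u \<times> 'u \<times> 'u \<Rightarrow> bool" where
  "coend_step H X Y p q \<longleftrightarrow>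
     (\<exists>h \<in> Arr H. \<exists>x \<in> Fobj X (Cod H h). \<exists>y \<in> Fobj Y (Dom H h).
        p = (Dom H h, act X h x, y) \<and> q = (Cod H h, x, act Y h y))"

definition coend_rel ::
    "'u gpd \<Rightarrow> 'u gset \<Rightarrow> 'u gset \<Rightarrow> (('u \<times> 'u \<times> 'u) \<times> ('u \<times> 'u \<times> 'u)) set" where
  "coend_rel H X Y = {(p, q). equivclp (coend_step H X Y) p q}"

text \<open>The co-end has to be a set of elements of \<open>'u\<close> again, so its points are names in \<open>'u\<close> of the
  equivalence classes. Distinct classes of one co-end get distinct names: see
  \<open>coend_elt_eq_iff\<close> below.\<close>

definition triple_code :: "'u \<times> 'u \<times> 'u \<Rightarrow> 'u::infinite" where
  "triple_code = (SOME f. inj f)"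

definition class_code :: "('u \<times> 'u \<times> 'u) set \<Rightarrow> 'u::infinite" where
  "class_code c = triple_code (SOME t. t \<in> c)"

definition coend :: "'u::infinite gpd \<Rightarrow> 'u gset \<Rightarrow> 'u gset \<Rightarrow> 'u set" where
  "coend H X Y = class_code ` (coend_triples H X Y // coend_rel H X Y)"

text \<open>The point \<open>[x, y]\<close>, for \<open>x\<close> in \<open>X\<^sup>\<eta>\<close> and \<open>y\<close> in \<open>Y\<^sub>\<eta>\<close>.\<close>

definition coend_elt :: "'u::infinite gpd \<Rightarrow> 'u gset \<Rightarrow> 'u gset \<Rightarrow> 'u \<times> 'u \<times> 'u \<Rightarrow> 'u" where
  "coend_elt H X Y t = class_code (coend_rel H X Y `` {t})"

text \<open>The map out of the co-end determined by \<open>[x, y] \<mapsto> f (\<eta>, x, y)\<close>; meaningful if \<open>f\<close> is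
  constant on classes.\<close>

definition coend_map ::
    "'u::infinite gpd \<Rightarrow> 'u gset \<Rightarrow> 'u gset \<Rightarrow> ('u \<times> 'u \<times> 'u \<Rightarrow> 'u) \<Rightarrow> 'u \<Rightarrow> 'u" where
  "coend_map H X Y f = (\<lambda>c \<in> coend H X Y.
     THE v. \<forall>t \<in> coend_triples H X Y. coend_elt H X Y t = c \<longrightarrow> f t = v)"

lemma inj_triple_code: "inj (triple_code :: 'u \<times> 'u \<times> 'u \<Rightarrow> 'u::infinite)"
proof -
  have inf: "infinite (UNIV :: 'u set)" by (rule infinite_UNIV)
  obtain f :: "'u \<times> 'u \<Rightarrow> 'u" where "bij_betw f (UNIV \<times> UNIV) UNIV"
    using card_of_ordIso[THEN iffD2, OF card_of_Times_same_infinite[OF inf]] by blast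
  then have "inj f" by (simp add: bij_betw_def)
  then have "inj (\<lambda>t. f (fst t, f (snd t)))"
    by (intro injI) (simp add: inj_eq prod_eq_iff)
  then show ?thesis
    unfolding triple_code_def by (rule someI[where P = inj])
qed

lemma coend_elt_in: "t \<in> coend_triples H X Y \<Longrightarrow> coend_elt H X Y t \<in> coend H X Y"
  by (auto simp: coend_elt_def coend_def quotient_def)

lemma coend_cases:
  assumes "c \<in> coend H X Y"
  obtains t where "t \<in> coend_triples H X Y" "c = coend_elt H X Y t"
  using assms by (auto simp: coend_elt_def coend_def quotient_def)

lemma coend_elt_eq_iff:
  "coend_elt H X Y s = coend_elt H X Y t \<longleftrightarrow> equivclp (coend_step H X Y) s t"
proof -
  let ?E = "equivclp (coend_step H X Y)"
  have E: "equivp ?E" by (rule equivp_evquivclp)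
  have rep: "?E u (SOME v. ?E u v)" for u
    by (rule someI[of "?E u" u]) (rule equivp_reflp[OF E])
  have "(SOME v. ?E s v) = (SOME v. ?E t v) \<longleftrightarrow> ?E s t"
  proof
    assume eq: "(SOME v. ?E s v) = (SOME v. ?E t v)"
    show "?E s t"
      by (rule equivp_transp[OF E rep[of s, unfolded eq] equivp_symp[OF E rep[of t]]])
  next
    assume "?E s t"
    then have "?E s = ?E t" using E[unfolded equivp_def, rule_format, of s t] by (rule iffD1[rotated])
    then show "(SOME v. ?E s v) = (SOME v. ?E t v)" by (rule arg_cong)
  qed
  moreover have "coend_elt H X Y u = triple_code (SOME v. ?E u v)" for u
    by (simp only: coend_elt_def class_code_def coend_rel_def Image_singleton_iff
        mem_Collect_eq case_prod_conv)
  ultimately show ?thesis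
    by (simp only: inj_eq[OF inj_triple_code])
qed


section \<open>The bicategory of groupoids and admissible bi-sets\<close>

text \<open>\<open>bracket K H G X Y \<kappa> \<gamma> (\<eta>, x, y)\<close> is the point \<open>[x, y]\<close> of \<open>X\<^sub>\<gamma> \<otimes>\<^sub>H Y\<^sup>\<kappa>\<close>, where \<open>X\<close> is an
  \<open>(H, G)\<close>-bi-set and \<open>Y\<close> is a \<open>(K, H)\<close>-bi-set.\<close>

abbreviation bracket_set ::
    "'u::infinite gpd \<Rightarrow> 'u gpd \<Rightarrow> 'u gpd \<Rightarrow> 'u biset \<Rightarrow> 'u biset \<Rightarrow> 'u \<Rightarrow> 'u \<Rightarrow> 'u set" where
  "bracket_set K H G X Y \<kappa> \<gamma> \<equiv> coend H (fix_lower H G X \<gamma>) (fix_upper K H Y \<kappa>)"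

abbreviation bracket ::
    "'u::infinite gpd \<Rightarrow> 'u gpd \<Rightarrow> 'u gpd \<Rightarrow> 'u biset \<Rightarrow> 'u biset \<Rightarrow> 'u \<Rightarrow> 'u \<Rightarrow>
     'u \<times> 'u \<times> 'u \<Rightarrow> 'u" where
  "bracket K H G X Y \<kappa> \<gamma> \<equiv> coend_elt H (fix_lower H G X \<gamma>) (fix_upper K H Y \<kappa>)"

abbreviation bracket_map ::
    "'u::infinite gpd \<Rightarrow> 'u gpd \<Rightarrow> 'u gpd \<Rightarrow> 'u biset \<Rightarrow> 'u biset \<Rightarrow> 'u \<Rightarrow> 'u \<Rightarrow>
     ('u \<times> 'u \<times> 'u \<Rightarrow> 'u) \<Rightarrow> 'u \<Rightarrow> 'u" where
  "bracket_map K H G X Y \<kappa> \<gamma> \<equiv> coend_map H (fix_lower H G X \<gamma>) (fix_upper K H Y \<kappa>)"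

text \<open>An arrow \<open>(k, g)\<close> of \<open>bi_cat K G\<close> goes from \<open>(Cod K k, Dom G g)\<close> to \<open>(Dom K k, Cod G g)\<close>.\<close>

definition tensor ::
    "'u::infinite gpd \<Rightarrow> 'u gpd \<Rightarrow> 'u gpd \<Rightarrow> 'u biset \<Rightarrow> 'u biset \<Rightarrow> 'u biset" where
  "tensor K H G X Y = \<lparr>
     Fobj = (\<lambda>(\<kappa>, \<gamma>) \<in> Obj (bi_cat K G). bracket_set K H G X Y \<kappa> \<gamma>),
     Farr = (\<lambda>(k, g) \<in> Arr (bi_cat K G).
       Arrow (bracket_set K H G X Y (Cod K k) (Dom G g))
         (bracket_map K H G X Y (Cod K k) (Dom G g) (\<lambda>(\<eta>, x, y).
            bracket K H G X Y (Dom K k) (Cod G g)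
              (\<eta>, act X (Ide H \<eta>, g) x, act Y (k, Ide H \<eta>) y)))
         (bracket_set K H G X Y (Dom K k) (Cod G g)))\<rparr>"

definition tensor_map ::
    "'u::infinite gpd \<Rightarrow> 'u gpd \<Rightarrow> 'u gpd \<Rightarrow> 'u biset_map \<Rightarrow> 'u biset_map \<Rightarrow> 'u biset_map" where
  "tensor_map K H G a b =
     Arrow (tensor K H G (src a) (src b))
       (\<lambda>(\<kappa>, \<gamma>) \<in> Obj (bi_cat K G).
          Arrow (bracket_set K H G (src a) (src b) \<kappa> \<gamma>)
            (bracket_map K H G (src a) (src b) \<kappa> \<gamma> (\<lambda>(\<eta>, x, y).
               bracket K H G (trg a) (trg b) \<kappa> \<gamma>
                 (\<eta>, amap (amap a (\<eta>, \<gamma>)) x, amap (amap b (\<kappa>, \<eta>)) y)))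
            (bracket_set K H G (trg a) (trg b) \<kappa> \<gamma>))
       (tensor K H G (trg a) (trg b))"

definition unit_biset :: "'u gpd \<Rightarrow> 'u biset" where
  "unit_biset G = \<lparr>
     Fobj = (\<lambda>(\<gamma>', \<gamma>) \<in> Obj (bi_cat G G). hom G \<gamma>' \<gamma>),
     Farr = (\<lambda>(h, g) \<in> Arr (bi_cat G G).
       Arrow (hom G (Cod G h) (Dom G g))
         (\<lambda>x \<in> hom G (Cod G h) (Dom G g). Comp G g (Comp G x h))
         (hom G (Dom G h) (Cod G g)))\<rparr>"

definition right_unitor :: "'u::infinite gpd \<Rightarrow> 'u gpd \<Rightarrow> 'u biset \<Rightarrow> 'u biset_map" where
  "right_unitor H G X =
     Arrow (tensor H H G X (unit_biset H))
       (\<lambda>(\<eta>, \<gamma>) \<in> Obj (bi_cat H G).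
          Arrow (bracket_set H H G X (unit_biset H) \<eta> \<gamma>)
            (bracket_map H H G X (unit_biset H) \<eta> \<gamma> (\<lambda>(\<eta>', x, h). act X (h, Ide G \<gamma>) x))
            (Fobj X (\<eta>, \<gamma>)))
       X"

definition left_unitor :: "'u::infinite gpd \<Rightarrow> 'u gpd \<Rightarrow> 'u biset \<Rightarrow> 'u biset_map" where
  "left_unitor H G Y =
     Arrow (tensor H G G (unit_biset G) Y)
       (\<lambda>(\<eta>, \<gamma>) \<in> Obj (bi_cat H G).
          Arrow (bracket_set H G G (unit_biset G) Y \<eta> \<gamma>)
            (bracket_map H G G (unit_biset G) Y \<eta> \<gamma> (\<lambda>(\<gamma>', g, y). act Y (Ide H \<eta>, g) y))
            (Fobj Y (\<eta>, \<gamma>)))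
       Y"

definition associator ::
    "'u::infinite gpd \<Rightarrow> 'u gpd \<Rightarrow> 'u gpd \<Rightarrow> 'u gpd \<Rightarrow> 'u biset \<Rightarrow> 'u biset \<Rightarrow> 'u biset \<Rightarrow>
     'u biset_map" where
  "associator K H G L X Y Z =
     Arrow (tensor K G L X (tensor K H G Y Z))
       (\<lambda>(\<kappa>, \<zeta>) \<in> Obj (bi_cat K L).
          Arrow (bracket_set K G L X (tensor K H G Y Z) \<kappa> \<zeta>)
            (bracket_map K G L X (tensor K H G Y Z) \<kappa> \<zeta> (\<lambda>(\<gamma>, x, w).
               bracket_map K H G Y Z \<kappa> \<gamma> (\<lambda>(\<eta>, y, z).
                 bracket K H L (tensor H G L X Y) Z \<kappa> \<zeta>
                   (\<eta>, bracket H G L X Y \<eta> \<zeta> (\<gamma>, x, y), z)) w))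
            (bracket_set K H L (tensor H G L X Y) Z \<kappa> \<zeta>))
       (tensor K H L (tensor H G L X Y) Z)"

definition biset_bicategory :: "('u::infinite gpd, 'u biset, 'u biset_map) bicategory_data" where
  "biset_bicategory = \<lparr>
     Ob0 = small_groupoids,
     Hom = biset_cat,
     HComp = (\<lambda>K H G. \<lparr>
       Fobj = (\<lambda>(X, Y) \<in> Obj (prod_cat (biset_cat H G) (biset_cat K H)). tensor K H G X Y),
       Farr = (\<lambda>(a, b) \<in> Arr (prod_cat (biset_cat H G) (biset_cat K H)). tensor_map K H G a b)\<rparr>),
     Unit = unit_biset,
     Assoc = associator,
     RUnit = right_unitor,
     LUnit = left_unitor\<rparr>"

end

theory Submission
  imports Defs
begin

text \<open>Since \<open>H\<close> is a groupoid, the zigzags defining \<open>X \<otimes>\<^sub>H Y\<close> compose to single steps: \<open>[x, y] =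
  [x', y']\<close> holds iff \<open>x = x'h\<close> and \<open>y' = hy\<close> for one arrow \<open>h\<close> of \<open>H\<close>. Freeness of \<open>Y\<close> forces
  \<open>h = 1\<close> when \<open>y = y'\<close>, whence \<open>X \<otimes>\<^sub>H Y\<close> is free; brackets of generators of \<open>Y\<close> with generators
  of \<open>X\<close> generate it. The same description of equality makes the induced maps, the unitors and the
  associator injective, and all coherence laws are then checked on brackets, because parallel maps
  of bi-sets that agree pointwise are equal.\<close>

section \<open>Elementwise description of bi-sets and their maps\<close>

text \<open>The points of a co-end are arbitrarily chosen names of equivalence classes, and maps out
  of it are given by a description operator. Neither yields a value until a formula on triples has
  been shown compatible with a single step of the relation. \<open>bracket_map_bracket\<close> turns
  such a check into an evaluation rule, after which each operation is used through its values on
  brackets. Since a tensor product is again a bi-set, the same rules serve for nested brackets.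
  2-cells are invertible by definition, so every candidate must be shown bijective on each value.
  For the unitors an inverse is written down. For tensor products of 2-cells and for the associator
  an inverse would again start at a co-end and call for another compatibility check, so injectivity
  and surjectivity are proved instead.\<close>

lemma bi_cat_simps [simp]:
  "Obj (bi_cat H G) = Obj H \<times> Obj G"
  "Arr (bi_cat H G) = Arr H \<times> Arr G"
  "Dom (bi_cat H G) (h, g) = (Cod H h, Dom G g)"
  "Cod (bi_cat H G) (h, g) = (Dom H h, Cod G g)"
  "Ide (bi_cat H G) (\<eta>, \<gamma>) = (Ide H \<eta>, Ide G \<gamma>)"
  "Comp (bi_cat H G) (h', g') (h, g) = (Comp H h h', Comp G g' g)"
  by (simp_all add: bi_cat_def prod_cat_def op_cat_def)

lemma prod_cat_simps [simp]:
  "Obj (prod_cat C D) = Obj C \<times> Obj D"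
  "Arr (prod_cat C D) = Arr C \<times> Arr D"
  "Dom (prod_cat C D) (f, g) = (Dom C f, Dom D g)"
  "Cod (prod_cat C D) (f, g) = (Cod C f, Cod D g)"
  "Ide (prod_cat C D) (x, y) = (Ide C x, Ide D y)"
  "Comp (prod_cat C D) (f', g') (f, g) = (Comp C f' f, Comp D g' g)"
  by (simp_all add: prod_cat_def)

lemma set_cat_simps [simp]:
  "Obj set_cat = UNIV"
  "f \<in> Arr set_cat \<longleftrightarrow> amap f \<in> src f \<rightarrow>\<^sub>E trg f"
  "Dom set_cat = src"
  "Cod set_cat = trg"
  "Ide set_cat A = Arrow A (\<lambda>x\<in>A. x) A"
  "Comp set_cat g f = Arrow (src f) (compose (src f) (amap g) (amap f)) (trg g)"
  by (simp_all add: set_cat_def)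

text \<open>Bijectivity can be checked on elements, so invertibility of a 2-cell becomes a condition
  on its component functions. The extensionality clause stays because an arrow of
  \<open>set_cat\<close> is a function restricted to its source.\<close>

lemma set_cat_is_iso_iff:
  "is_iso set_cat A B f \<longleftrightarrow>
    src f = A \<and> trg f = B \<and> amap f \<in> extensional A \<and> bij_betw (amap f) A B"
proof
  assume "is_iso set_cat A B f"
  then obtain g where f: "src f = A" "trg f = B" "amap f \<in> A \<rightarrow>\<^sub>E B"
    and g: "src g = B" "trg g = A" "amap g \<in> B \<rightarrow>\<^sub>E A"
    and gf: "compose A (amap g) (amap f) = (\<lambda>x\<in>A. x)"
    and fg: "compose B (amap f) (amap g) = (\<lambda>x\<in>B. x)"
    by (auto simp: is_iso_def hom_def)
  have "amap g (amap f x) = x" if "x \<in> A" for x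
    using fun_cong[OF gf, of x] that by (simp add: compose_def)
  moreover have "amap f (amap g y) = y" if "y \<in> B" for y
    using fun_cong[OF fg, of y] that by (simp add: compose_def)
  ultimately have "bij_betw (amap f) A B"
    using f g by (intro bij_betwI[where g = "amap g"]) auto
  then show "src f = A \<and> trg f = B \<and> amap f \<in> extensional A \<and> bij_betw (amap f) A B"
    using f by (auto simp: PiE_def)
next
  assume f: "src f = A \<and> trg f = B \<and> amap f \<in> extensional A \<and> bij_betw (amap f) A B"
  \<comment> \<open>The inverse function has to be cut down to \<open>B\<close>, since arrows of
    \<open>set_cat\<close> are \<open>undefined\<close> off their source.\<close>
  let ?g = "Arrow B (restrict (inv_into A (amap f)) B) A"
  have "inv_into A (amap f) \<in> B \<rightarrow> A"
    using f bij_betw_inv_into bij_betw_imp_funcset by blast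
  moreover have "compose A (restrict (inv_into A (amap f)) B) (amap f) = (\<lambda>x\<in>A. x)"
    using f by (auto simp: compose_def restrict_def fun_eq_iff bij_betw_def)
  moreover have "compose B (amap f) (restrict (inv_into A (amap f)) B) = (\<lambda>x\<in>B. x)"
    using f by (auto simp: compose_def restrict_def fun_eq_iff bij_betw_def f_inv_into_f)
  moreover have "amap f \<in> A \<rightarrow>\<^sub>E B"
    using f by (auto simp: PiE_def bij_betw_def)
  ultimately show "is_iso set_cat A B f"
    using f unfolding is_iso_def hom_def
    by (intro conjI bexI[where x = ?g]) (auto simp: restrict_PiE_iff)
qed

section \<open>Composition of arrows in categories and groupoids\<close>

context category
begin

lemma Ide_simps [simp]:
  "x \<in> Obj C \<Longrightarrow> Ide C x \<in> Arr C"
  "x \<in> Obj C \<Longrightarrow> Dom C (Ide C x) = x"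
  "x \<in> Obj C \<Longrightarrow> Cod C (Ide C x) = x"
  using Ide_in by (auto simp: hom_def)

text \<open>The axioms speak of \<open>hom\<close>, whose end points do not occur in the composite.
  Here they are replaced by side conditions on \<open>Dom\<close> and \<open>Cod\<close> that
  rewriting can discharge.\<close>

lemma Comp_simps [simp]:
  assumes "f \<in> Arr C" "g \<in> Arr C" "Cod C f = Dom C g"
  shows "Comp C g f \<in> Arr C" "Dom C (Comp C g f) = Dom C f" "Cod C (Comp C g f) = Cod C g"
  using Comp_in[of f "Dom C f" "Dom C g" g "Cod C g"] assms by (auto simp: hom_def)

lemma Comp_Ide_simps [simp]:
  "f \<in> Arr C \<Longrightarrow> Dom C f = x \<Longrightarrow> Comp C f (Ide C x) = f"
  "f \<in> Arr C \<Longrightarrow> Cod C f = x \<Longrightarrow> Comp C (Ide C x) f = f"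
  using Comp_Ide Ide_Comp by (auto simp: hom_def)

text \<open>Orients associativity towards right-nested composites. It is invoked explicitly, mostly
  to cancel an inverse.\<close>

lemma Comp_assoc':
  assumes "f \<in> Arr C" "g \<in> Arr C" "h \<in> Arr C" "Cod C f = Dom C g" "Cod C g = Dom C h"
  shows "Comp C (Comp C h g) f = Comp C h (Comp C g f)"
  using Comp_assoc[of f "Dom C f" "Dom C g" g "Dom C h" h "Cod C h"] assms by (auto simp: hom_def)

lemmas Dom_Cod_in [simp] = Dom_in Cod_in

end

lemma (in groupoid) obtain_inverse:
  assumes "f \<in> Arr C"
  obtains g where "g \<in> Arr C" "Dom C g = Cod C f" "Cod C g = Dom C f"
    "Comp C g f = Ide C (Dom C f)" "Comp C f g = Ide C (Cod C f)"
  using all_iso[OF assms] unfolding is_iso_def hom_def by blast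

text \<open>Functoriality is reduced to elements: two arrows of \<open>set_cat\<close> with the same
  source and target are equal once their extensional maps agree on the source. The index
  \<open>(Cod H h, Dom G g)\<close> at which \<open>(h, g)\<close> starts reflects contravariance in
  \<open>H\<close>.\<close>

lemma is_bisetI:
  assumes "Fobj X \<in> extensional (Obj H \<times> Obj G)" "Farr X \<in> extensional (Arr H \<times> Arr G)"
    and "\<And>h g. \<lbrakk>h \<in> Arr H; g \<in> Arr G\<rbrakk> \<Longrightarrow> src (Farr X (h, g)) = Fobj X (Cod H h, Dom G g)"
    and "\<And>h g. \<lbrakk>h \<in> Arr H; g \<in> Arr G\<rbrakk> \<Longrightarrow> trg (Farr X (h, g)) = Fobj X (Dom H h, Cod G g)"
    and "\<And>h g. \<lbrakk>h \<in> Arr H; g \<in> Arr G\<rbrakk> \<Longrightarrow>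
      amap (Farr X (h, g)) \<in> extensional (Fobj X (Cod H h, Dom G g))"
    and "\<And>h g x. \<lbrakk>h \<in> Arr H; g \<in> Arr G; x \<in> Fobj X (Cod H h, Dom G g)\<rbrakk> \<Longrightarrow>
      act X (h, g) x \<in> Fobj X (Dom H h, Cod G g)"
    and "\<And>\<eta> \<gamma> x. \<lbrakk>\<eta> \<in> Obj H; \<gamma> \<in> Obj G; x \<in> Fobj X (\<eta>, \<gamma>)\<rbrakk> \<Longrightarrow>
      act X (Ide H \<eta>, Ide G \<gamma>) x = x"
    and "\<And>h g h' g' x. \<lbrakk>h \<in> Arr H; g \<in> Arr G; h' \<in> Arr H; g' \<in> Arr G; Cod H h' = Dom H h;
        Cod G g = Dom G g'; x \<in> Fobj X (Cod H h, Dom G g)\<rbrakk> \<Longrightarrow>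
      act X (Comp H h h', Comp G g' g) x = act X (h', g') (act X (h, g) x)"
    and "category H" "category G"
  shows "is_biset H G X"
proof -
  interpret H: category H by fact
  interpret G: category G by fact
  show ?thesis
    unfolding is_biset_def is_functor_def
  proof (intro conjI ballI impI)
    show "Fobj X \<in> Obj (bi_cat H G) \<rightarrow>\<^sub>E Obj set_cat"
      using assms(1) by (simp add: PiE_def)
    show "Farr X \<in> Arr (bi_cat H G) \<rightarrow>\<^sub>E Arr set_cat"
      using assms(2-6) by (auto simp: PiE_def act_def)
  next
    fix f assume "f \<in> Arr (bi_cat H G)"
    then show "Dom set_cat (Farr X f) = Fobj X (Dom (bi_cat H G) f)"
      and "Cod set_cat (Farr X f) = Fobj X (Cod (bi_cat H G) f)"
      using assms(3,4) by (cases f; auto)+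
  next
    fix p assume "p \<in> Obj (bi_cat H G)"
    then obtain \<eta> \<gamma> where p: "p = (\<eta>, \<gamma>)" "\<eta> \<in> Obj H" "\<gamma> \<in> Obj G" by auto
    have "amap (Farr X (Ide H \<eta>, Ide G \<gamma>)) = (\<lambda>x\<in>Fobj X (\<eta>, \<gamma>). x)"
      using p assms(5)[of "Ide H \<eta>" "Ide G \<gamma>"] assms(7)
      by (intro extensionalityI[where A = "Fobj X (\<eta>, \<gamma>)"]) (auto simp: act_def)
    then show "Farr X (Ide (bi_cat H G) p) = Ide set_cat (Fobj X p)"
      using p by (intro arrow.expand) (simp add: assms)
  next
    fix u v assume "u \<in> Arr (bi_cat H G)" "v \<in> Arr (bi_cat H G)"
      and "Cod (bi_cat H G) u = Dom (bi_cat H G) v"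
    then obtain h g h' g' where u: "u = (h, g)" "h \<in> Arr H" "g \<in> Arr G"
      and v: "v = (h', g')" "h' \<in> Arr H" "g' \<in> Arr G"
      and c: "Cod H h' = Dom H h" "Cod G g = Dom G g'"
      by (cases u; cases v) auto
    have "amap (Farr X (Comp H h h', Comp G g' g)) =
        compose (Fobj X (Cod H h, Dom G g)) (amap (Farr X v)) (amap (Farr X u))"
      using u v c assms(5)[of "Comp H h h'" "Comp G g' g"] assms(8)[of h g h' g']
      by (intro extensionalityI[where A = "Fobj X (Cod H h, Dom G g)"]) (auto simp: act_def compose_def)
    then show "Farr X (Comp (bi_cat H G) v u) = Comp set_cat (Farr X v) (Farr X u)"
      using u v c by (intro arrow.expand) (simp add: assms)
  qed
qed

section \<open>Two-sided actions, orbits and generators\<close>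

locale biset = H: groupoid H + G: groupoid G
  for H G :: "'u gpd" +
  fixes X :: "'u biset"
  assumes is_biset: "is_biset H G X"
begin

lemma functor_facts:
  "Fobj X \<in> extensional (Obj H \<times> Obj G)"
  "Farr X \<in> extensional (Arr H \<times> Arr G)"
  "\<lbrakk>h \<in> Arr H; g \<in> Arr G\<rbrakk> \<Longrightarrow> src (Farr X (h, g)) = Fobj X (Cod H h, Dom G g)"
  "\<lbrakk>h \<in> Arr H; g \<in> Arr G\<rbrakk> \<Longrightarrow> trg (Farr X (h, g)) = Fobj X (Dom H h, Cod G g)"
  "\<lbrakk>h \<in> Arr H; g \<in> Arr G\<rbrakk> \<Longrightarrow>
    amap (Farr X (h, g)) \<in> Fobj X (Cod H h, Dom G g) \<rightarrow>\<^sub>E Fobj X (Dom H h, Cod G g)"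
  "\<lbrakk>\<eta> \<in> Obj H; \<gamma> \<in> Obj G\<rbrakk> \<Longrightarrow> Farr X (Ide H \<eta>, Ide G \<gamma>) = Ide set_cat (Fobj X (\<eta>, \<gamma>))"
  "\<lbrakk>h \<in> Arr H; g \<in> Arr G; h' \<in> Arr H; g' \<in> Arr G; Cod H h' = Dom H h; Cod G g = Dom G g'\<rbrakk> \<Longrightarrow>
    Farr X (Comp H h h', Comp G g' g) = Comp set_cat (Farr X (h', g')) (Farr X (h, g))"
proof -
  note F = is_biset[unfolded is_biset_def is_functor_def]
  show "Fobj X \<in> extensional (Obj H \<times> Obj G)" "Farr X \<in> extensional (Arr H \<times> Arr G)"
    using F by (auto simp: PiE_def)
  show s: "src (Farr X (h, g)) = Fobj X (Cod H h, Dom G g)"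
    and t: "trg (Farr X (h, g)) = Fobj X (Dom H h, Cod G g)" if "h \<in> Arr H" "g \<in> Arr G" for h g
    using F that by auto
  show "amap (Farr X (h, g)) \<in> Fobj X (Cod H h, Dom G g) \<rightarrow>\<^sub>E Fobj X (Dom H h, Cod G g)"
    if hg: "h \<in> Arr H" "g \<in> Arr G"
  proof -
    have "Farr X (h, g) \<in> Arr set_cat"
      using F hg PiE_mem[of "Farr X" "Arr (bi_cat H G)" "\<lambda>_. Arr set_cat" "(h, g)"] by simp
    then show ?thesis using s[OF hg] t[OF hg] by simp
  qed
  show "Farr X (Ide H \<eta>, Ide G \<gamma>) = Ide set_cat (Fobj X (\<eta>, \<gamma>))" if "\<eta> \<in> Obj H" "\<gamma> \<in> Obj G"
    using F that by fastforce
  show "Farr X (Comp H h h', Comp G g' g) = Comp set_cat (Farr X (h', g')) (Farr X (h, g))"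
    if "h \<in> Arr H" "g \<in> Arr G" "h' \<in> Arr H" "g' \<in> Arr G" "Cod H h' = Dom H h" "Cod G g = Dom G g'"
  proof -
    have "\<forall>f\<in>Arr (bi_cat H G). \<forall>g\<in>Arr (bi_cat H G). Cod (bi_cat H G) f = Dom (bi_cat H G) g \<longrightarrow>
        Farr X (Comp (bi_cat H G) g f) = Comp set_cat (Farr X g) (Farr X f)"
      using F by blast
    from this[rule_format, of "(h, g)" "(h', g')"] that show ?thesis by simp
  qed
qed

text \<open>The target indices are variables tied by equations, so the rule also fires on goals
  whose index is not literally \<open>Dom H h\<close> or \<open>Cod G g\<close>.\<close>

lemma act_in [simp]:
  "\<lbrakk>h \<in> Arr H; g \<in> Arr G; x \<in> Fobj X (Cod H h, Dom G g); Dom H h = \<eta>; Cod G g = \<gamma>\<rbrakk> \<Longrightarrow>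
    act X (h, g) x \<in> Fobj X (\<eta>, \<gamma>)"
  using functor_facts(5)[of h g] by (auto simp: act_def)

lemma act_Ide [simp]:
  "\<lbrakk>\<eta> \<in> Obj H; \<gamma> \<in> Obj G; x \<in> Fobj X (\<eta>, \<gamma>)\<rbrakk> \<Longrightarrow> act X (Ide H \<eta>, Ide G \<gamma>) x = x"
  by (simp add: act_def functor_facts(6))

text \<open>Collapses iterated actions into the action of one composite, the normal form in which
  later proofs compare elements.\<close>

lemma act_act [simp]:
  "\<lbrakk>h \<in> Arr H; g \<in> Arr G; h' \<in> Arr H; g' \<in> Arr G; Cod H h' = Dom H h; Cod G g = Dom G g';
    x \<in> Fobj X (Cod H h, Dom G g)\<rbrakk> \<Longrightarrow>
    act X (h', g') (act X (h, g) x) = act X (Comp H h h', Comp G g' g) x"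
  by (simp add: act_def functor_facts compose_def)

lemma fix_upper_Fobj [simp]: "\<gamma> \<in> Obj G \<Longrightarrow> Fobj (fix_upper H G X \<eta>) \<gamma> = Fobj X (\<eta>, \<gamma>)"
  and fix_lower_Fobj [simp]: "\<eta> \<in> Obj H \<Longrightarrow> Fobj (fix_lower H G X \<gamma>) \<eta> = Fobj X (\<eta>, \<gamma>)"
  and fix_upper_act [simp]: "g \<in> Arr G \<Longrightarrow> act (fix_upper H G X \<eta>) g x = act X (Ide H \<eta>, g) x"
  and fix_lower_act [simp]: "h \<in> Arr H \<Longrightarrow> act (fix_lower H G X \<gamma>) h x = act X (h, Ide G \<gamma>) x"
  by (simp_all add: fix_upper_def fix_lower_def act_def)

text \<open>A zigzag collapses to one arrow: a forward step composes with the arrow found so far,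
  and a backward step along \<open>k\<close> is a forward step along the inverse of
  \<open>k\<close>. Thus the colimit is the set of orbits.\<close>

lemma same_colim_classD:
  assumes "equivclp (colim_step G (fix_upper H G X \<eta>)) p q" "\<eta> \<in> Obj H"
    and "p = (\<gamma>, x)" "\<gamma> \<in> Obj G" "x \<in> Fobj X (\<eta>, \<gamma>)"
  shows "\<exists>g\<in>Arr G. Dom G g = \<gamma> \<and> q = (Cod G g, act X (Ide H \<eta>, g) x)"
  using assms(1)
proof (induction rule: equivclp_induct)
  case base
  then show ?case using assms by (intro bexI[of _ "Ide G \<gamma>"]) auto
next
  case (step q r)
  from step.IH obtain g where g: "g \<in> Arr G" "Dom G g = \<gamma>"
    and q: "q = (Cod G g, act X (Ide H \<eta>, g) x)" by blast
  from step.hyps(2) show ?case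
  proof
    assume "colim_step G (fix_upper H G X \<eta>) q r"
    then obtain k where "k \<in> Arr G" "Dom G k = Cod G g"
      "r = (Cod G k, act X (Ide H \<eta>, k) (act X (Ide H \<eta>, g) x))"
      by (auto simp: colim_step_def q)
    then show ?thesis using g assms by (intro bexI[of _ "Comp G k g"]) auto
  next
    assume "colim_step G (fix_upper H G X \<eta>) r q"
    then obtain k z where k: "k \<in> Arr G" "z \<in> Fobj X (\<eta>, Dom G k)" "r = (Dom G k, z)"
      "Cod G g = Cod G k" "act X (Ide H \<eta>, g) x = act X (Ide H \<eta>, k) z"
      by (auto simp: colim_step_def q)
    obtain l where l: "l \<in> Arr G" "Dom G l = Cod G k" "Cod G l = Dom G k"
      "Comp G l k = Ide G (Dom G k)"
      using G.obtain_inverse[OF k(1)] by metis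
    \<comment> \<open>The inverse \<open>l\<close> recovers \<open>z\<close> from
      \<open>kz = gx\<close>, so the backward step extends the arrow \<open>g\<close> to
      \<open>l g\<close>.\<close>
    have "z = act X (Ide H \<eta>, l) (act X (Ide H \<eta>, k) z)" using k l assms by simp
    also have "\<dots> = act X (Ide H \<eta>, l) (act X (Ide H \<eta>, g) x)" using k(5) by simp
    also have "\<dots> = act X (Ide H \<eta>, Comp G l g) x" using k(4) l(1,2) g assms by simp
    finally have z: "z = act X (Ide H \<eta>, Comp G l g) x" .
    then have "r = (Cod G (Comp G l g), act X (Ide H \<eta>, Comp G l g) x)" using k(1,3,4) l(1-3) g(1) by simp
    moreover have "Comp G l g \<in> Arr G" "Dom G (Comp G l g) = \<gamma>" using k(4) l(1,2) g by simp_all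
    ultimately show ?thesis by blast
  qed
qed

text \<open>Finiteness of a quotient is exchanged for a finite set of generators, one or more in
  each orbit, which can be followed through a tensor product. A generator is recorded together with
  its object because the values of \<open>X\<close> at different objects may overlap as
  sets.\<close>

lemma finitely_generated_iff:
  assumes \<eta>: "\<eta> \<in> Obj H"
  shows "finitely_generated G (fix_upper H G X \<eta>) \<longleftrightarrow>
    (\<exists>S. finite S \<and> S \<subseteq> (SIGMA \<gamma>:Obj G. Fobj X (\<eta>, \<gamma>)) \<and>
      (\<forall>\<gamma>\<in>Obj G. \<forall>x\<in>Fobj X (\<eta>, \<gamma>). \<exists>g\<in>Arr G. \<exists>x'. (Dom G g, x') \<in> S \<and> Cod G g = \<gamma> \<and>
        x = act X (Ide H \<eta>, g) x'))"
    (is "_ \<longleftrightarrow> (\<exists>S. finite S \<and> S \<subseteq> ?T \<and> ?gen S)")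
proof -
  let ?E = "equivclp (colim_step G (fix_upper H G X \<eta>))"
  let ?R = "{(p, q). ?E p q}"
  have T: "(SIGMA \<gamma>:Obj G. Fobj (fix_upper H G X \<eta>) \<gamma>) = ?T" by auto
  have E: "equivp ?E" by (rule equivp_evquivclp)
  show ?thesis
  proof
    assume "finitely_generated G (fix_upper H G X \<eta>)"
    then have fin: "finite (?T // ?R)"
      by (simp add: finitely_generated_def colim_def T)
    \<comment> \<open>Membership in \<open>?T\<close> is built into the choice, so a representative
      is at once known to lie in one of the values of \<open>X\<close>.\<close>
    define rep where "rep c = (SOME p. p \<in> c \<and> p \<in> ?T)" for c
    have rep: "rep c \<in> c \<and> rep c \<in> ?T" if "c \<in> ?T // ?R" for c
    proof -
      from that obtain p where "p \<in> ?T" "c = ?R `` {p}" by (auto elim: quotientE)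
      then have "p \<in> c \<and> p \<in> ?T" using equivp_reflp[OF E, of p] by auto
      then show ?thesis unfolding rep_def by (rule someI)
    qed
    have "?gen (rep ` (?T // ?R))"
    proof (intro ballI)
      fix \<gamma> x assume x: "\<gamma> \<in> Obj G" "x \<in> Fobj X (\<eta>, \<gamma>)"
      let ?c = "?R `` {(\<gamma>, x)}"
      have c: "?c \<in> ?T // ?R" using x by (intro quotientI) simp
      obtain \<gamma>' x' where r: "rep ?c = (\<gamma>', x')" by (cases "rep ?c")
      with rep[OF c] have x': "\<gamma>' \<in> Obj G" "x' \<in> Fobj X (\<eta>, \<gamma>')" "?E (\<gamma>, x) (\<gamma>', x')" by auto
      then have "?E (\<gamma>', x') (\<gamma>, x)" using equivp_symp[OF E] by blast
      from same_colim_classD[OF this \<eta> refl x'(1,2)]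
      obtain g where "g \<in> Arr G" "Dom G g = \<gamma>'" "\<gamma> = Cod G g" "x = act X (Ide H \<eta>, g) x'" by auto
      then show "\<exists>g\<in>Arr G. \<exists>x'. (Dom G g, x') \<in> rep ` (?T // ?R) \<and> Cod G g = \<gamma> \<and>
          x = act X (Ide H \<eta>, g) x'"
        using c r by (intro bexI[of _ g] exI[of _ x']) (auto intro: image_eqI[of _ rep ?c])
    qed
    moreover have "rep ` (?T // ?R) \<subseteq> ?T" using rep by blast
    ultimately show "\<exists>S. finite S \<and> S \<subseteq> ?T \<and> ?gen S"
      using fin by (intro exI[of _ "rep ` (?T // ?R)"]) simp
  next
    assume "\<exists>S. finite S \<and> S \<subseteq> ?T \<and> ?gen S"
    then obtain S where S: "finite S" "S \<subseteq> ?T" "?gen S" by blast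
    \<comment> \<open>Every class contains a generator, so the finitely many classes of elements of
      \<open>S\<close> exhaust the quotient.\<close>
    have "?T // ?R \<subseteq> (\<lambda>p. ?R `` {p}) ` S"
    proof
      fix c assume "c \<in> ?T // ?R"
      then obtain \<gamma> x where x: "\<gamma> \<in> Obj G" "x \<in> Fobj X (\<eta>, \<gamma>)" and c: "c = ?R `` {(\<gamma>, x)}"
        by (auto elim!: quotientE)
      from S(3) x obtain g x' where g: "g \<in> Arr G" "(Dom G g, x') \<in> S" "Cod G g = \<gamma>"
        "x = act X (Ide H \<eta>, g) x'" by meson
      have "x' \<in> Fobj X (\<eta>, Dom G g)" using g S(2) by auto
      then have "colim_step G (fix_upper H G X \<eta>) (Dom G g, x') (\<gamma>, x)"
        using g by (auto simp: colim_step_def)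
      then have "?E (Dom G g, x') (\<gamma>, x)" by (rule r_into_equivclp)
      then have "?E (Dom G g, x') = ?E (\<gamma>, x)" using E by (simp add: equivp_def)
      then have "c = ?R `` {(Dom G g, x')}" by (auto simp: c)
      then show "c \<in> (\<lambda>p. ?R `` {p}) ` S" using g by blast
    qed
    then show "finitely_generated G (fix_upper H G X \<eta>)"
      unfolding finitely_generated_def colim_def T
      using S(1) finite_subset by blast
  qed
qed

lemma free_gset_iff:
  "free_gset G (fix_upper H G X \<eta>) \<longleftrightarrow>
    (\<forall>g\<in>Arr G. \<forall>g'\<in>Arr G. \<forall>x\<in>Fobj X (\<eta>, Dom G g). Dom G g' = Dom G g \<longrightarrow> Cod G g' = Cod G g \<longrightarrow>
      act X (Ide H \<eta>, g) x = act X (Ide H \<eta>, g') x \<longrightarrow> g = g')" (is "_ \<longleftrightarrow> ?R")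
proof
  assume "free_gset G (fix_upper H G X \<eta>)"
  then have inj: "inj_on (\<lambda>g. act (fix_upper H G X \<eta>) g x) (hom G \<gamma>' \<gamma>)"
    if "\<gamma> \<in> Obj G" "\<gamma>' \<in> Obj G" "x \<in> Fobj X (\<eta>, \<gamma>')" for \<gamma> \<gamma>' x
    using that by (simp add: free_gset_def)
  show ?R
  proof (intro ballI impI)
    fix g g' x
    assume "g \<in> Arr G" "g' \<in> Arr G" "x \<in> Fobj X (\<eta>, Dom G g)" "Dom G g' = Dom G g"
      "Cod G g' = Cod G g" "act X (Ide H \<eta>, g) x = act X (Ide H \<eta>, g') x"
    then show "g = g'"
      by - (rule inj_onD[OF inj[of "Cod G g" "Dom G g" x]],  simp_all add: hom_def)
  qed
next
  assume ?R then show "free_gset G (fix_upper H G X \<eta>)"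
    by (auto simp: free_gset_def inj_on_def hom_def)
qed

end

locale admissible_biset = biset +
  assumes admissible: "admissible H G X"
begin

lemma free:
  "\<lbrakk>\<eta> \<in> Obj H; g \<in> Arr G; g' \<in> Arr G; Dom G g' = Dom G g; Cod G g' = Cod G g;
    x \<in> Fobj X (\<eta>, Dom G g); act X (Ide H \<eta>, g) x = act X (Ide H \<eta>, g') x\<rbrakk> \<Longrightarrow> g = g'"
  using admissible free_gset_iff unfolding admissible_def by blast

lemma obtain_generators:
  assumes "\<eta> \<in> Obj H"
  obtains S where "finite S" "S \<subseteq> (SIGMA \<gamma>:Obj G. Fobj X (\<eta>, \<gamma>))"
    "\<And>\<gamma> x. \<lbrakk>\<gamma> \<in> Obj G; x \<in> Fobj X (\<eta>, \<gamma>)\<rbrakk> \<Longrightarrow>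
      \<exists>g\<in>Arr G. \<exists>x'. (Dom G g, x') \<in> S \<and> Cod G g = \<gamma> \<and> x = act X (Ide H \<eta>, g) x'"
  using admissible finitely_generated_iff[OF assms] assms unfolding admissible_def by metis

end

section \<open>The groupoid of admissible bi-sets\<close>

lemma admissible_bisetI: "\<lbrakk>groupoid H; groupoid G; admissible H G X\<rbrakk> \<Longrightarrow> admissible_biset H G X"
  by (simp add: admissible_biset_def admissible_biset_axioms_def biset_def biset_axioms_def
      admissible_def)

lemma biset_cat_simps [simp]:
  "X \<in> Obj (biset_cat H G) \<longleftrightarrow> admissible H G X"
  "Dom (biset_cat H G) = src"
  "Cod (biset_cat H G) = trg"
  by (simp_all add: biset_cat_def)

abbreviation app :: "'u biset_map \<Rightarrow> 'u \<Rightarrow> 'u \<Rightarrow> 'u \<Rightarrow> 'u" where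
  "app a \<eta> \<gamma> x \<equiv> amap (amap a (\<eta>, \<gamma>)) x"

text \<open>A natural isomorphism is a family of equivariant bijections: bijectivity makes the
  components invertible, and \<open>eqv\<close> is the naturality square evaluated at an element.
  The conditions on sources, targets and extensionality place the record itself in the
  hom-set.\<close>

lemma in_hom_biset_catI:
  assumes "groupoid H" "groupoid G" "admissible H G X" "admissible H G X'"
    and "src a = X" "trg a = X'" "amap a \<in> extensional (Obj H \<times> Obj G)"
    and "\<And>\<eta> \<gamma>. \<lbrakk>\<eta> \<in> Obj H; \<gamma> \<in> Obj G\<rbrakk> \<Longrightarrow> src (amap a (\<eta>, \<gamma>)) = Fobj X (\<eta>, \<gamma>)"
    and "\<And>\<eta> \<gamma>. \<lbrakk>\<eta> \<in> Obj H; \<gamma> \<in> Obj G\<rbrakk> \<Longrightarrow> trg (amap a (\<eta>, \<gamma>)) = Fobj X' (\<eta>, \<gamma>)"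
    and "\<And>\<eta> \<gamma>. \<lbrakk>\<eta> \<in> Obj H; \<gamma> \<in> Obj G\<rbrakk> \<Longrightarrow> amap (amap a (\<eta>, \<gamma>)) \<in> extensional (Fobj X (\<eta>, \<gamma>))"
    and "\<And>\<eta> \<gamma>. \<lbrakk>\<eta> \<in> Obj H; \<gamma> \<in> Obj G\<rbrakk> \<Longrightarrow>
      bij_betw (amap (amap a (\<eta>, \<gamma>))) (Fobj X (\<eta>, \<gamma>)) (Fobj X' (\<eta>, \<gamma>))"
    and eqv: "\<And>h g x. \<lbrakk>h \<in> Arr H; g \<in> Arr G; x \<in> Fobj X (Cod H h, Dom G g)\<rbrakk> \<Longrightarrow>
      app a (Dom H h) (Cod G g) (act X (h, g) x) = act X' (h, g) (app a (Cod H h) (Dom G g) x)"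
  shows "a \<in> hom (biset_cat H G) X X'"
proof -
  interpret X: admissible_biset H G X using assms by (intro admissible_bisetI)
  interpret X': admissible_biset H G X' using assms by (intro admissible_bisetI)
  have "Comp set_cat (amap a (Cod (bi_cat H G) f)) (Farr X f) =
      Comp set_cat (Farr X' f) (amap a (Dom (bi_cat H G) f))" if "f \<in> Arr (bi_cat H G)" for f
  proof -
    from that obtain h g where f: "f = (h, g)" "h \<in> Arr H" "g \<in> Arr G" by auto
    have "compose (Fobj X (Cod H h, Dom G g)) (amap (amap a (Dom H h, Cod G g))) (amap (Farr X (h, g))) =
        compose (Fobj X (Cod H h, Dom G g)) (amap (Farr X' (h, g))) (amap (amap a (Cod H h, Dom G g)))"
      using eqv f by (auto simp: compose_def act_def)
    then show ?thesis
      using f assms by (simp add: X.functor_facts X'.functor_facts)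
  qed
  moreover have "\<forall>p\<in>Obj (bi_cat H G). is_iso set_cat (Fobj X p) (Fobj X' p) (amap a p)"
    using assms by (auto simp: set_cat_is_iso_iff)
  ultimately have "nat_iso (bi_cat H G) set_cat X X' (amap a)"
    using assms(7) unfolding nat_iso_def bi_cat_simps by blast
  then show ?thesis
    using assms(3-6) by (simp add: hom_def biset_cat_def)
qed

locale biset_map = dom: admissible_biset H G X + cod: admissible_biset H G X'
  for H G :: "'u gpd" and X X' :: "'u biset" +
  fixes a :: "'u biset_map"
  assumes in_hom: "a \<in> hom (biset_cat H G) X X'"
begin

lemma src_trg [simp]: "src a = X" "trg a = X'"
  using in_hom by (auto simp: hom_def)

lemma component:
  assumes "\<eta> \<in> Obj H" "\<gamma> \<in> Obj G"
  shows src_component: "src (amap a (\<eta>, \<gamma>)) = Fobj X (\<eta>, \<gamma>)"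
    and trg_component: "trg (amap a (\<eta>, \<gamma>)) = Fobj X' (\<eta>, \<gamma>)"
    and ext_component: "amap (amap a (\<eta>, \<gamma>)) \<in> extensional (Fobj X (\<eta>, \<gamma>))"
    and bij_component: "bij_betw (amap (amap a (\<eta>, \<gamma>))) (Fobj X (\<eta>, \<gamma>)) (Fobj X' (\<eta>, \<gamma>))"
  using in_hom assms by (auto simp: hom_def biset_cat_def nat_iso_def set_cat_is_iso_iff)

lemma amap_ext: "amap a \<in> extensional (Obj H \<times> Obj G)"
  using in_hom by (auto simp: hom_def biset_cat_def nat_iso_def)

lemma app_in [simp]:
  "\<lbrakk>\<eta> \<in> Obj H; \<gamma> \<in> Obj G; x \<in> Fobj X (\<eta>, \<gamma>)\<rbrakk> \<Longrightarrow> app a \<eta> \<gamma> x \<in> Fobj X' (\<eta>, \<gamma>)"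
  using bij_component by (auto simp: bij_betw_def)

lemma app_eq_iff:
  "\<lbrakk>\<eta> \<in> Obj H; \<gamma> \<in> Obj G; x \<in> Fobj X (\<eta>, \<gamma>); x' \<in> Fobj X (\<eta>, \<gamma>)\<rbrakk> \<Longrightarrow>
    app a \<eta> \<gamma> x = app a \<eta> \<gamma> x' \<longleftrightarrow> x = x'"
  using bij_component[of \<eta> \<gamma>] by (auto simp: bij_betw_def inj_on_eq_iff)

lemma app_surj:
  assumes "\<eta> \<in> Obj H" "\<gamma> \<in> Obj G" "x' \<in> Fobj X' (\<eta>, \<gamma>)"
  obtains x where "x \<in> Fobj X (\<eta>, \<gamma>)" "x' = app a \<eta> \<gamma> x"
  using bij_component[OF assms(1,2)] assms(3) by (auto simp: bij_betw_def)

text \<open>As a rewrite rule this moves actions outwards past a 2-cell, where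
  \<open>act_act\<close> can merge them.\<close>

lemma app_act [simp]:
  assumes "h \<in> Arr H" "g \<in> Arr G" "x \<in> Fobj X (Cod H h, Dom G g)" "Dom H h = \<eta>" "Cod G g = \<gamma>"
  shows "app a \<eta> \<gamma> (act X (h, g) x) = act X' (h, g) (app a (Cod H h) (Dom G g) x)"
proof -
  have "Comp set_cat (amap a (\<eta>, \<gamma>)) (Farr X (h, g)) =
      Comp set_cat (Farr X' (h, g)) (amap a (Cod H h, Dom G g))"
    using in_hom assms by (fastforce simp: hom_def biset_cat_def nat_iso_def)
  then have "compose (Fobj X (Cod H h, Dom G g)) (amap (amap a (\<eta>, \<gamma>))) (amap (Farr X (h, g))) x =
      compose (Fobj X (Cod H h, Dom G g)) (amap (Farr X' (h, g))) (amap (amap a (Cod H h, Dom G g))) x"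
    using assms by (simp add: dom.functor_facts src_component)
  then show ?thesis using assms by (simp add: compose_def act_def)
qed

end

lemma biset_mapI:
  "\<lbrakk>groupoid H; groupoid G; a \<in> hom (biset_cat H G) X X'\<rbrakk> \<Longrightarrow> biset_map H G X X' a"
  by (auto simp: biset_map_def biset_map_axioms_def hom_def biset_cat_def intro: admissible_bisetI)

text \<open>Both the family and each of its component functions are \<open>undefined\<close> off
  their domains, and sources and targets are dictated by \<open>X\<close> and \<open>X'\<close>.
  Hence the values on elements determine the whole record.\<close>

lemma biset_map_eqI:
  assumes "groupoid H" "groupoid G"
    and a: "a \<in> hom (biset_cat H G) X X'" and b: "b \<in> hom (biset_cat H G) X X'"
    and eq: "\<And>\<eta> \<gamma> x. \<lbrakk>\<eta> \<in> Obj H; \<gamma> \<in> Obj G; x \<in> Fobj X (\<eta>, \<gamma>)\<rbrakk> \<Longrightarrow> app a \<eta> \<gamma> x = app b \<eta> \<gamma> x"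
  shows "a = b"
proof -
  interpret a: biset_map H G X X' a using assms by (intro biset_mapI)
  interpret b: biset_map H G X X' b using assms by (intro biset_mapI)
  have "amap a p = amap b p" if "p \<in> Obj H \<times> Obj G" for p
  proof -
    from that obtain \<eta> \<gamma> where p: "p = (\<eta>, \<gamma>)" "\<eta> \<in> Obj H" "\<gamma> \<in> Obj G" by auto
    have "amap (amap a p) = amap (amap b p)"
      using p eq a.ext_component b.ext_component
      by (intro extensionalityI[where A = "Fobj X (\<eta>, \<gamma>)"]) auto
    then show ?thesis using p
      by (intro arrow.expand) (simp add: a.component b.component)
  qed
  then have "amap a = amap b"
    using a.amap_ext b.amap_ext by (intro extensionalityI)
  then show ?thesis by (intro arrow.expand) simp
qed

lemma app_Ide [simp]:
  "\<lbrakk>\<eta> \<in> Obj H; \<gamma> \<in> Obj G; x \<in> Fobj X (\<eta>, \<gamma>)\<rbrakk> \<Longrightarrow> app (Ide (biset_cat H G) X) \<eta> \<gamma> x = x"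
  by (simp add: biset_cat_def)

lemma Ide_in_hom:
  assumes "groupoid H" "groupoid G" "admissible H G X"
  shows "Ide (biset_cat H G) X \<in> hom (biset_cat H G) X X"
proof -
  interpret X: admissible_biset H G X using assms by (intro admissible_bisetI)
  have "Ide (biset_cat H G) X =
      Arrow X (\<lambda>p\<in>Obj H \<times> Obj G. Arrow (Fobj X p) (\<lambda>x\<in>Fobj X p. x) (Fobj X p)) X"
    by (simp add: biset_cat_def)
  then show ?thesis
    using assms by (intro in_hom_biset_catI) (auto simp: bij_betw_def inj_on_def)
qed

lemma app_Comp:
  assumes "groupoid H" "groupoid G"
    and "a \<in> hom (biset_cat H G) X X'" "b \<in> hom (biset_cat H G) X' X''"
    and "\<eta> \<in> Obj H" "\<gamma> \<in> Obj G" "x \<in> Fobj X (\<eta>, \<gamma>)"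
  shows "app (Comp (biset_cat H G) b a) \<eta> \<gamma> x = app b \<eta> \<gamma> (app a \<eta> \<gamma> x)"
proof -
  interpret a: biset_map H G X X' a using assms by (intro biset_mapI)
  show ?thesis using assms by (simp add: biset_cat_def compose_def a.src_component)
qed

lemma Comp_in_hom:
  assumes "groupoid H" "groupoid G"
    and "a \<in> hom (biset_cat H G) X X'" "b \<in> hom (biset_cat H G) X' X''"
  shows "Comp (biset_cat H G) b a \<in> hom (biset_cat H G) X X''"
proof -
  interpret a: biset_map H G X X' a using assms by (intro biset_mapI)
  interpret b: biset_map H G X' X'' b using assms by (intro biset_mapI)
  let ?c = "Comp (biset_cat H G) b a"
  have c: "src (amap ?c (\<eta>, \<gamma>)) = Fobj X (\<eta>, \<gamma>)" "trg (amap ?c (\<eta>, \<gamma>)) = Fobj X'' (\<eta>, \<gamma>)"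
    "amap (amap ?c (\<eta>, \<gamma>)) =
      compose (Fobj X (\<eta>, \<gamma>)) (amap (amap b (\<eta>, \<gamma>))) (amap (amap a (\<eta>, \<gamma>)))"
    if "\<eta> \<in> Obj H" "\<gamma> \<in> Obj G" for \<eta> \<gamma>
    using that by (simp_all add: biset_cat_def a.component b.component)
  show ?thesis
  proof (intro in_hom_biset_catI)
    show "amap ?c \<in> extensional (Obj H \<times> Obj G)" by (simp add: biset_cat_def)
  next
    fix \<eta> \<gamma> assume "\<eta> \<in> Obj H" "\<gamma> \<in> Obj G"
    then show "bij_betw (amap (amap ?c (\<eta>, \<gamma>))) (Fobj X (\<eta>, \<gamma>)) (Fobj X'' (\<eta>, \<gamma>))"
      using bij_betw_compose[OF a.bij_component b.bij_component] c by simp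
  next
    fix h g x assume "h \<in> Arr H" "g \<in> Arr G" "x \<in> Fobj X (Cod H h, Dom G g)"
    then show "app ?c (Dom H h) (Cod G g) (act X (h, g) x) =
        act X'' (h, g) (app ?c (Cod H h) (Dom G g) x)"
      by (simp add: app_Comp[OF assms])
  qed (use assms c a.dom.admissible b.cod.admissible in \<open>auto simp: biset_cat_def\<close>)
qed

lemma biset_map_inverse:
  assumes "groupoid H" "groupoid G" "a \<in> hom (biset_cat H G) X X'"
  obtains b where "b \<in> hom (biset_cat H G) X' X"
    "Comp (biset_cat H G) b a = Ide (biset_cat H G) X"
    "Comp (biset_cat H G) a b = Ide (biset_cat H G) X'"
proof -
  interpret a: biset_map H G X X' a using assms by (intro biset_mapI)
  define b where "b = Arrow X' (\<lambda>p\<in>Obj H \<times> Obj G. Arrow (Fobj X' p)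
    (restrict (inv_into (Fobj X p) (amap (amap a p))) (Fobj X' p)) (Fobj X p)) X"
  have app_b: "app b \<eta> \<gamma> (app a \<eta> \<gamma> x) = x" if "\<eta> \<in> Obj H" "\<gamma> \<in> Obj G" "x \<in> Fobj X (\<eta>, \<gamma>)" for \<eta> \<gamma> x
    using that a.bij_component[of \<eta> \<gamma>] by (simp add: b_def bij_betw_def)
  have b: "b \<in> hom (biset_cat H G) X' X"
  proof (intro in_hom_biset_catI)
    fix \<eta> \<gamma> assume "\<eta> \<in> Obj H" "\<gamma> \<in> Obj G"
    then show "bij_betw (amap (amap b (\<eta>, \<gamma>))) (Fobj X' (\<eta>, \<gamma>)) (Fobj X (\<eta>, \<gamma>))"
      using bij_betw_inv_into[OF a.bij_component, of \<eta> \<gamma>] by (simp add: b_def cong: bij_betw_cong)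
  next
    \<comment> \<open>By surjectivity the point has the form \<open>a z\<close>. Equivariance of
      \<open>b\<close> there follows from equivariance of \<open>a\<close> at \<open>z\<close> and
      from \<open>b (a z) = z\<close>.\<close>
    fix h g x assume hg: "h \<in> Arr H" "g \<in> Arr G" and "x \<in> Fobj X' (Cod H h, Dom G g)"
    then obtain z where z: "z \<in> Fobj X (Cod H h, Dom G g)" "x = app a (Cod H h) (Dom G g) z"
      using a.app_surj[of "Cod H h" "Dom G g" x] by auto
    have "act X' (h, g) x = app a (Dom H h) (Cod G g) (act X (h, g) z)" using hg z by simp
    then show "app b (Dom H h) (Cod G g) (act X' (h, g) x) =
        act X (h, g) (app b (Cod H h) (Dom G g) x)"
      using hg z(1) app_b[of "Dom H h" "Cod G g" "act X (h, g) z"]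
        app_b[of "Cod H h" "Dom G g" "z"] unfolding z(2) by simp
  qed (use assms a.dom.admissible a.cod.admissible in \<open>auto simp: b_def\<close>)
  interpret b: biset_map H G X' X b using assms b by (intro biset_mapI)
  have "app a \<eta> \<gamma> (app b \<eta> \<gamma> x) = x" if x: "\<eta> \<in> Obj H" "\<gamma> \<in> Obj G" "x \<in> Fobj X' (\<eta>, \<gamma>)" for \<eta> \<gamma> x
    using a.app_surj[OF x] x app_b by metis
  then have "Comp (biset_cat H G) a b = Ide (biset_cat H G) X'"
    using assms b a.cod.admissible
    by (intro biset_map_eqI[OF assms(1,2) Comp_in_hom Ide_in_hom]) (auto simp: app_Comp)
  moreover have "Comp (biset_cat H G) b a = Ide (biset_cat H G) X"
    using assms b a.dom.admissible app_b
    by (intro biset_map_eqI[OF assms(1,2) Comp_in_hom Ide_in_hom]) (auto simp: app_Comp)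
  ultimately show thesis using b that by blast
qed

text \<open>As all 2-cells are invertible, the isomorphism axioms for unitors and associators reduce
  to membership in a hom-set.\<close>

lemma is_iso_biset_cat_iff:
  assumes "groupoid H" "groupoid G"
  shows "is_iso (biset_cat H G) X X' a \<longleftrightarrow> a \<in> hom (biset_cat H G) X X'"
  unfolding is_iso_def using biset_map_inverse[OF assms] by metis

lemma groupoid_biset_cat:
  assumes "groupoid H" "groupoid G"
  shows "groupoid (biset_cat H G)"
proof
  note in_hom = Ide_in_hom[OF assms] Comp_in_hom[OF assms]
  note eqI = biset_map_eqI[OF assms]
  show "Dom (biset_cat H G) f \<in> Obj (biset_cat H G)" "Cod (biset_cat H G) f \<in> Obj (biset_cat H G)"
    if "f \<in> Arr (biset_cat H G)" for f
    using that by (simp_all add: biset_cat_def)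
  show "is_iso (biset_cat H G) (Dom (biset_cat H G) f) (Cod (biset_cat H G) f) f"
    if "f \<in> Arr (biset_cat H G)" for f
    using that by (simp add: is_iso_biset_cat_iff[OF assms] hom_def)
  show "Ide (biset_cat H G) X \<in> hom (biset_cat H G) X X" if "X \<in> Obj (biset_cat H G)" for X
    using that in_hom by simp
  show "Comp (biset_cat H G) g f \<in> hom (biset_cat H G) X Z"
    if "f \<in> hom (biset_cat H G) X Y" "g \<in> hom (biset_cat H G) Y Z" for f g X Y Z
    using that in_hom by simp
  show "Comp (biset_cat H G) f (Ide (biset_cat H G) X) = f"
    and "Comp (biset_cat H G) (Ide (biset_cat H G) Y) f = f"
    if f: "f \<in> hom (biset_cat H G) X Y" for f X Y
  proof -
    interpret f: biset_map H G X Y f using assms f by (intro biset_mapI)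
    note i = in_hom(1)[OF f.dom.admissible] in_hom(1)[OF f.cod.admissible]
    show "Comp (biset_cat H G) f (Ide (biset_cat H G) X) = f"
      using app_Comp[OF assms i(1) f] by (intro eqI[OF in_hom(2)[OF i(1) f] f]) simp
    show "Comp (biset_cat H G) (Ide (biset_cat H G) Y) f = f"
      using app_Comp[OF assms f i(2)] by (intro eqI[OF in_hom(2)[OF f i(2)] f]) simp
  qed
  show "Comp (biset_cat H G) h (Comp (biset_cat H G) g f) =
      Comp (biset_cat H G) (Comp (biset_cat H G) h g) f"
    if f: "f \<in> hom (biset_cat H G) W X" and g: "g \<in> hom (biset_cat H G) X Y"
      and h: "h \<in> hom (biset_cat H G) Y Z" for f g h W X Y Z
  proof -
    interpret f: biset_map H G W X f using assms f by (intro biset_mapI)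
    note gf = in_hom(2)[OF f g] and hg = in_hom(2)[OF g h]
    show ?thesis
      using app_Comp[OF assms gf h] app_Comp[OF assms f g] app_Comp[OF assms f hg]
        app_Comp[OF assms g h]
      by (intro eqI[OF in_hom(2)[OF gf h] in_hom(2)[OF f hg]]) simp
  qed
qed

section \<open>Calculus of brackets\<close>

text \<open>Invariance under one step propagates along a zigzag, so \<open>f\<close> is constant on
  the class of \<open>t\<close>. The description in \<open>coend_map\<close> then has a unique
  solution, \<open>t\<close> itself excluding any other value.\<close>

lemma coend_map_elt:
  assumes "t \<in> coend_triples H X Y"
    and step: "\<And>h x y. \<lbrakk>h \<in> Arr H; x \<in> Fobj X (Cod H h); y \<in> Fobj Y (Dom H h)\<rbrakk> \<Longrightarrow>
      f (Dom H h, act X h x, y) = f (Cod H h, x, act Y h y)"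
  shows "coend_map H X Y f (coend_elt H X Y t) = f t"
proof -
  have "f s = f t" if "coend_elt H X Y s = coend_elt H X Y t" for s
    using that[symmetric] unfolding coend_elt_eq_iff
    by (induction rule: equivclp_induct) (auto simp: coend_step_def step)
  then have "(THE v. \<forall>s\<in>coend_triples H X Y. coend_elt H X Y s = coend_elt H X Y t \<longrightarrow> f s = v) = f t"
    using assms(1) by (intro the_equality) blast+
  then show ?thesis using assms(1) by (simp add: coend_map_def coend_elt_in)
qed

locale biset_pair = X: admissible_biset H G X + Y: admissible_biset K H Y
  for K H G :: "'u::infinite gpd" and X Y :: "'u biset"
begin

text \<open>Hides the co-end behind the tensor product, so that the rules for bi-sets apply to it.
  Proofs that unfold \<open>tensor_def\<close> switch the rule off, because the two rewrites undo
  each other.\<close>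

lemma bracket_set_eq [simp]:
  "\<lbrakk>\<kappa> \<in> Obj K; \<gamma> \<in> Obj G\<rbrakk> \<Longrightarrow> bracket_set K H G X Y \<kappa> \<gamma> = Fobj (tensor K H G X Y) (\<kappa>, \<gamma>)"
  by (simp add: tensor_def)

lemma bracket_in [simp]:
  "\<lbrakk>\<kappa> \<in> Obj K; \<gamma> \<in> Obj G; \<eta> \<in> Obj H; x \<in> Fobj X (\<eta>, \<gamma>); y \<in> Fobj Y (\<kappa>, \<eta>)\<rbrakk> \<Longrightarrow>
    bracket K H G X Y \<kappa> \<gamma> (\<eta>, x, y) \<in> Fobj (tensor K H G X Y) (\<kappa>, \<gamma>)"
  by (auto simp: coend_triples_def simp flip: bracket_set_eq intro!: coend_elt_in)

lemma bracket_cases: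
  assumes "w \<in> Fobj (tensor K H G X Y) (\<kappa>, \<gamma>)" "\<kappa> \<in> Obj K" "\<gamma> \<in> Obj G"
  obtains \<eta> x y where "\<eta> \<in> Obj H" "x \<in> Fobj X (\<eta>, \<gamma>)" "y \<in> Fobj Y (\<kappa>, \<eta>)"
    "w = bracket K H G X Y \<kappa> \<gamma> (\<eta>, x, y)"
  using assms by (auto simp: coend_triples_def simp flip: bracket_set_eq elim!: coend_cases)

lemma bracket_slide:
  assumes "\<kappa> \<in> Obj K" "\<gamma> \<in> Obj G" "h \<in> Arr H" "x \<in> Fobj X (Cod H h, \<gamma>)" "y \<in> Fobj Y (\<kappa>, Dom H h)"
  shows "bracket K H G X Y \<kappa> \<gamma> (Dom H h, act X (h, Ide G \<gamma>) x, y) =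
    bracket K H G X Y \<kappa> \<gamma> (Cod H h, x, act Y (Ide K \<kappa>, h) y)"
  unfolding coend_elt_eq_iff using assms
  by (intro r_into_equivclp) (auto simp: coend_step_def)

text \<open>Induction along the zigzag with the start \<open>(\<eta>, x, y)\<close> fixed: the
  current triple always carries some \<open>x'\<close> and \<open>hy\<close> with
  \<open>x = x'h\<close>.\<close>

lemma equivclp_coend_stepD:
  assumes "equivclp (coend_step H (fix_lower H G X \<gamma>) (fix_upper K H Y \<kappa>)) p q"
    and \<kappa>: "\<kappa> \<in> Obj K" and \<gamma>: "\<gamma> \<in> Obj G"
    and p: "p = (\<eta>, x, y)" "\<eta> \<in> Obj H" "x \<in> Fobj X (\<eta>, \<gamma>)" "y \<in> Fobj Y (\<kappa>, \<eta>)"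
  shows "\<exists>h\<in>Arr H. \<exists>x'\<in>Fobj X (Cod H h, \<gamma>). Dom H h = \<eta> \<and> x = act X (h, Ide G \<gamma>) x' \<and>
    q = (Cod H h, x', act Y (Ide K \<kappa>, h) y)"
  using assms(1)
proof (induction rule: equivclp_induct)
  case base
  then show ?case using assms by (intro bexI[of _ "Ide H \<eta>"] bexI[of _ x]) auto
next
  case (step q r)
  from step.IH obtain h x' where h: "h \<in> Arr H" "x' \<in> Fobj X (Cod H h, \<gamma>)" "Dom H h = \<eta>"
    "x = act X (h, Ide G \<gamma>) x'" and q: "q = (Cod H h, x', act Y (Ide K \<kappa>, h) y)" by blast
  from step.hyps(2) show ?case
  proof
    assume "coend_step H (fix_lower H G X \<gamma>) (fix_upper K H Y \<kappa>) q r"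
    then obtain k z where k: "k \<in> Arr H" "Dom H k = Cod H h" "z \<in> Fobj X (Cod H k, \<gamma>)"
      "x' = act X (k, Ide G \<gamma>) z" "r = (Cod H k, z, act Y (Ide K \<kappa>, k) (act Y (Ide K \<kappa>, h) y))"
      by (auto simp: coend_step_def q)
    \<comment> \<open>\<open>x = x'h = (zk)h = z(kh)\<close> and
      \<open>k(hy) = (kh)y\<close>.\<close>
    show ?thesis
      using h k p \<kappa> \<gamma> by (intro bexI[of _ "Comp H k h"] bexI[of _ z]) auto
  next
    assume "coend_step H (fix_lower H G X \<gamma>) (fix_upper K H Y \<kappa>) r q"
    then obtain k z where k: "k \<in> Arr H" "Cod H k = Cod H h" "z \<in> Fobj Y (\<kappa>, Dom H k)"
      and z: "act Y (Ide K \<kappa>, h) y = act Y (Ide K \<kappa>, k) z" and r: "r = (Dom H k, act X (k, Ide G \<gamma>) x', z)"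
      by (auto simp: coend_step_def q)
    \<comment> \<open>Cancelling \<open>k\<close> in \<open>hy = kz\<close> by its inverse
      \<open>l\<close> gives \<open>z = (lh)y\<close>, so the new arrow is
      \<open>l h\<close>.\<close>
    obtain l where l: "l \<in> Arr H" "Dom H l = Cod H k" "Cod H l = Dom H k"
      "Comp H l k = Ide H (Dom H k)" "Comp H k l = Ide H (Cod H k)"
      using X.H.obtain_inverse[OF k(1)] by metis
    have "z = act Y (Ide K \<kappa>, l) (act Y (Ide K \<kappa>, k) z)" using k l \<kappa> by simp
    also have "\<dots> = act Y (Ide K \<kappa>, l) (act Y (Ide K \<kappa>, h) y)" using z by simp
    also have "\<dots> = act Y (Ide K \<kappa>, Comp H l h) y" using k l h p \<kappa> by simp
    finally have "r = (Cod H (Comp H l h), act X (k, Ide G \<gamma>) x', act Y (Ide K \<kappa>, Comp H l h) y)"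
      using r k(2) l(1-3) h(1) by simp
    moreover have "x = act X (Comp H l h, Ide G \<gamma>) (act X (k, Ide G \<gamma>) x')"
    proof -
      \<comment> \<open>Since \<open>k l = 1\<close>, one has
        \<open>x = x'h = x'(k(lh)) = (x'k)(lh)\<close>.\<close>
      have "Comp H k (Comp H l h) = h"
        using X.H.Comp_assoc'[of h l k] h(1) k(1,2) l by simp
      then show ?thesis using h k(1,2) l(1-3) \<gamma> by simp
    qed
    ultimately show ?thesis
      using h k(1,2) l(1-3) \<gamma> by (intro bexI[of _ "Comp H l h"] bexI[of _ "act X (k, Ide G \<gamma>) x'"]) auto
  qed
qed

text \<open>Converse of \<open>bracket_slide\<close> in elimination form. The two together decide
  every equality of brackets.\<close>

lemma bracket_eqD:
  assumes "bracket K H G X Y \<kappa> \<gamma> (\<eta>, x, y) = bracket K H G X Y \<kappa> \<gamma> (\<eta>', x', y')"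
    and "\<kappa> \<in> Obj K" "\<gamma> \<in> Obj G" "\<eta> \<in> Obj H" "x \<in> Fobj X (\<eta>, \<gamma>)" "y \<in> Fobj Y (\<kappa>, \<eta>)"
  obtains h where "h \<in> Arr H" "Dom H h = \<eta>" "Cod H h = \<eta>'"
    "x = act X (h, Ide G \<gamma>) x'" "y' = act Y (Ide K \<kappa>, h) y"
  using equivclp_coend_stepD[OF assms(1)[unfolded coend_elt_eq_iff] assms(2,3) refl assms(4-)] by blast

text \<open>The last premise is compatibility with a single slide, which is what has to be verified
  for each map out of a tensor product.\<close>

lemma bracket_map_bracket:
  assumes "\<kappa> \<in> Obj K" "\<gamma> \<in> Obj G" "\<eta> \<in> Obj H" "x \<in> Fobj X (\<eta>, \<gamma>)" "y \<in> Fobj Y (\<kappa>, \<eta>)"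
    and "\<And>h x y. \<lbrakk>h \<in> Arr H; x \<in> Fobj X (Cod H h, \<gamma>); y \<in> Fobj Y (\<kappa>, Dom H h)\<rbrakk> \<Longrightarrow>
      f (Dom H h, act X (h, Ide G \<gamma>) x, y) = f (Cod H h, x, act Y (Ide K \<kappa>, h) y)"
  shows "bracket_map K H G X Y \<kappa> \<gamma> f (bracket K H G X Y \<kappa> \<gamma> (\<eta>, x, y)) = f (\<eta>, x, y)"
  by (rule coend_map_elt) (use assms in \<open>auto simp: coend_triples_def\<close>)

lemma bracket_map_ext:
  "\<kappa> \<in> Obj K \<Longrightarrow> \<gamma> \<in> Obj G \<Longrightarrow>
    bracket_map K H G X Y \<kappa> \<gamma> f \<in> extensional (Fobj (tensor K H G X Y) (\<kappa>, \<gamma>))"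
  by (simp add: coend_map_def)

text \<open>Well defined because the actions of \<open>g\<close> and \<open>k\<close> commute with
  sliding an arrow \<open>h\<close> across the bracket: the required equality is the slide of
  \<open>h\<close> between \<open>gx\<close> and \<open>yk\<close>.\<close>

lemma act_tensor [simp]:
  assumes "k \<in> Arr K" "g \<in> Arr G" "Cod K k = \<kappa>" "Dom G g = \<gamma>"
    and "\<eta> \<in> Obj H" "x \<in> Fobj X (\<eta>, \<gamma>)" "y \<in> Fobj Y (\<kappa>, \<eta>)"
  shows "act (tensor K H G X Y) (k, g) (bracket K H G X Y \<kappa> \<gamma> (\<eta>, x, y)) =
    bracket K H G X Y (Dom K k) (Cod G g) (\<eta>, act X (Ide H \<eta>, g) x, act Y (k, Ide H \<eta>) y)"
proof -
  let ?f = "\<lambda>(\<eta>, x, y). bracket K H G X Y (Dom K k) (Cod G g)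
    (\<eta>, act X (Ide H \<eta>, g) x, act Y (k, Ide H \<eta>) y)"
  have "bracket_map K H G X Y \<kappa> \<gamma> ?f (bracket K H G X Y \<kappa> \<gamma> (\<eta>, x, y)) = ?f (\<eta>, x, y)"
  proof (rule bracket_map_bracket)
    fix h x y assume "h \<in> Arr H" "x \<in> Fobj X (Cod H h, \<gamma>)" "y \<in> Fobj Y (\<kappa>, Dom H h)"
    then show "?f (Dom H h, act X (h, Ide G \<gamma>) x, y) = ?f (Cod H h, x, act Y (Ide K \<kappa>, h) y)"
      using assms bracket_slide[of "Dom K k" "Cod G g" h "act X (Ide H (Cod H h), g) x"
        "act Y (k, Ide H (Dom H h)) y"] by auto
  qed (use assms in auto)
  moreover have "amap (Farr (tensor K H G X Y) (k, g)) = bracket_map K H G X Y \<kappa> \<gamma> ?f"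
    using assms by (simp add: tensor_def del: bracket_set_eq)
  ultimately show ?thesis by (simp add: act_def[of "tensor K H G X Y"])
qed

lemma is_biset_tensor: "is_biset K G (tensor K H G X Y)"
proof (rule is_bisetI)
  let ?T = "tensor K H G X Y"
  show "Fobj ?T \<in> extensional (Obj K \<times> Obj G)" "Farr ?T \<in> extensional (Arr K \<times> Arr G)"
    by (simp_all add: tensor_def del: bracket_set_eq)
  show "src (Farr ?T (k, g)) = Fobj ?T (Cod K k, Dom G g)"
    and "trg (Farr ?T (k, g)) = Fobj ?T (Dom K k, Cod G g)"
    and "amap (Farr ?T (k, g)) \<in> extensional (Fobj ?T (Cod K k, Dom G g))"
    if "k \<in> Arr K" "g \<in> Arr G" for k g
    using that by (simp_all add: tensor_def coend_map_def del: bracket_set_eq)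
  show "act ?T (k, g) w \<in> Fobj ?T (Dom K k, Cod G g)"
    if "k \<in> Arr K" "g \<in> Arr G" "w \<in> Fobj ?T (Cod K k, Dom G g)" for k g w
    using that by (elim bracket_cases) auto
  show "act ?T (Ide K \<kappa>, Ide G \<gamma>) w = w"
    if "\<kappa> \<in> Obj K" "\<gamma> \<in> Obj G" "w \<in> Fobj ?T (\<kappa>, \<gamma>)" for \<kappa> \<gamma> w
    using that(3,1,2) by (elim bracket_cases) auto
  show "act ?T (Comp K k k', Comp G g' g) w = act ?T (k', g') (act ?T (k, g) w)"
    if "k \<in> Arr K" "g \<in> Arr G" "k' \<in> Arr K" "g' \<in> Arr G" "Cod K k' = Dom K k" "Cod G g = Dom G g'"
      "w \<in> Fobj ?T (Cod K k, Dom G g)" for k g k' g' w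
    using that(7,1-6) by (elim bracket_cases) auto
qed unfold_locales

lemma admissible_tensor: "admissible K G (tensor K H G X Y)"
proof -
  interpret T: biset K G "tensor K H G X Y"
    by unfold_locales (rule is_biset_tensor)
  have "free_gset G (fix_upper K G (tensor K H G X Y) \<kappa>)" if \<kappa>: "\<kappa> \<in> Obj K" for \<kappa>
    unfolding T.free_gset_iff
  proof (intro ballI impI)
    fix g g' w assume g: "g \<in> Arr G" "g' \<in> Arr G" "Dom G g' = Dom G g" "Cod G g' = Cod G g"
      and w: "w \<in> Fobj (tensor K H G X Y) (\<kappa>, Dom G g)"
      and eq: "act (tensor K H G X Y) (Ide K \<kappa>, g) w = act (tensor K H G X Y) (Ide K \<kappa>, g') w"
    from w \<kappa> g obtain \<eta> x y where x: "\<eta> \<in> Obj H" "x \<in> Fobj X (\<eta>, Dom G g)" "y \<in> Fobj Y (\<kappa>, \<eta>)"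
      and w: "w = bracket K H G X Y \<kappa> (Dom G g) (\<eta>, x, y)" by (auto elim: bracket_cases)
    \<comment> \<open>Acting on the left factor only, \<open>g\<close> and \<open>g'\<close> give
      two brackets with the same right factor \<open>y\<close>.\<close>
    have "bracket K H G X Y \<kappa> (Cod G g) (\<eta>, act X (Ide H \<eta>, g) x, y) =
        bracket K H G X Y \<kappa> (Cod G g) (\<eta>, act X (Ide H \<eta>, g') x, y)"
      using eq \<kappa> g x by (simp add: w)
    then obtain h where h: "h \<in> Arr H" "Dom H h = \<eta>" "Cod H h = \<eta>" "y = act Y (Ide K \<kappa>, h) y"
      "act X (Ide H \<eta>, g) x = act X (h, Ide G (Cod G g)) (act X (Ide H \<eta>, g') x)"
      by (rule bracket_eqD) (use \<kappa> g x in auto)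
    have "act Y (Ide K \<kappa>, h) y = act Y (Ide K \<kappa>, Ide H \<eta>) y"
      using h(4)[symmetric] \<kappa> x by simp
    then have "h = Ide H \<eta>" using \<kappa> x h(1-3) by - (rule Y.free[of \<kappa> h "Ide H \<eta>" y], simp_all)
    then have "act X (Ide H \<eta>, g) x = act X (Ide H \<eta>, g') x" using h(5) g x by simp
    then show "g = g'" using g x by - (rule X.free[of \<eta> g g' x], simp_all)
  qed
  moreover have "finitely_generated G (fix_upper K G (tensor K H G X Y) \<kappa>)" if \<kappa>: "\<kappa> \<in> Obj K" for \<kappa>
  proof -
    obtain S where S: "finite S" "S \<subseteq> (SIGMA \<eta>:Obj H. Fobj Y (\<kappa>, \<eta>))"
      "\<And>\<eta> y. \<lbrakk>\<eta> \<in> Obj H; y \<in> Fobj Y (\<kappa>, \<eta>)\<rbrakk> \<Longrightarrow>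
        \<exists>h\<in>Arr H. \<exists>y'. (Dom H h, y') \<in> S \<and> Cod H h = \<eta> \<and> y = act Y (Ide K \<kappa>, h) y'"
      using Y.obtain_generators[OF \<kappa>] by blast
    \<comment> \<open>Generators of \<open>X\<close> are chosen for all objects of \<open>H\<close>
      at once, although \<open>Q\<close> below uses \<open>R \<eta>\<close> only for the objects
      that occur in the finite set \<open>S\<close>. This keeps \<open>Q\<close> finite.\<close>
    have "\<forall>\<eta>\<in>Obj H. \<exists>R. finite R \<and> R \<subseteq> (SIGMA \<gamma>:Obj G. Fobj X (\<eta>, \<gamma>)) \<and>
      (\<forall>\<gamma> x. \<gamma> \<in> Obj G \<longrightarrow> x \<in> Fobj X (\<eta>, \<gamma>) \<longrightarrow>
        (\<exists>g\<in>Arr G. \<exists>x'. (Dom G g, x') \<in> R \<and> Cod G g = \<gamma> \<and> x = act X (Ide H \<eta>, g) x'))"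
      by (metis X.obtain_generators)
    then obtain R where R: "\<And>\<eta>. \<eta> \<in> Obj H \<Longrightarrow> finite (R \<eta>)"
      "\<And>\<eta>. \<eta> \<in> Obj H \<Longrightarrow> R \<eta> \<subseteq> (SIGMA \<gamma>:Obj G. Fobj X (\<eta>, \<gamma>))"
      "\<And>\<eta> \<gamma> x. \<lbrakk>\<eta> \<in> Obj H; \<gamma> \<in> Obj G; x \<in> Fobj X (\<eta>, \<gamma>)\<rbrakk> \<Longrightarrow>
        \<exists>g\<in>Arr G. \<exists>x'. (Dom G g, x') \<in> R \<eta> \<and> Cod G g = \<gamma> \<and> x = act X (Ide H \<eta>, g) x'"
      by metis
    define Q where "Q = (\<Union>(\<eta>, y)\<in>S. (\<lambda>(\<gamma>, x). (\<gamma>, bracket K H G X Y \<kappa> \<gamma> (\<eta>, x, y))) ` R \<eta>)"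
    have "finite Q" using S(1,2) R(1) by (auto simp: Q_def)
    moreover have "Q \<subseteq> (SIGMA \<gamma>:Obj G. Fobj (tensor K H G X Y) (\<kappa>, \<gamma>))"
      using S(2) R(2) \<kappa> by (fastforce simp: Q_def)
    moreover have gen: "\<exists>g\<in>Arr G. \<exists>w'. (Dom G g, w') \<in> Q \<and> Cod G g = \<gamma> \<and>
        w = act (tensor K H G X Y) (Ide K \<kappa>, g) w'"
      if \<gamma>: "\<gamma> \<in> Obj G" and w: "w \<in> Fobj (tensor K H G X Y) (\<kappa>, \<gamma>)" for \<gamma> w
    proof -
      from w \<kappa> \<gamma> obtain \<eta> x y where x: "\<eta> \<in> Obj H" "x \<in> Fobj X (\<eta>, \<gamma>)" "y \<in> Fobj Y (\<kappa>, \<eta>)"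
        and w: "w = bracket K H G X Y \<kappa> \<gamma> (\<eta>, x, y)" by (auto elim: bracket_cases)
      from S(3)[OF x(1,3)] obtain h y' where h: "h \<in> Arr H" "(Dom H h, y') \<in> S" "Cod H h = \<eta>"
        and y: "y = act Y (Ide K \<kappa>, h) y'" by blast
      have y': "y' \<in> Fobj Y (\<kappa>, Dom H h)" using S(2) h(2) by auto
      have "act X (h, Ide G \<gamma>) x \<in> Fobj X (Dom H h, \<gamma>)" using h x \<gamma> by simp
      from R(3)[OF _ \<gamma> this] h(1) obtain g x' where g: "g \<in> Arr G" "(Dom G g, x') \<in> R (Dom H h)"
        "Cod G g = \<gamma>" and x'': "act X (h, Ide G \<gamma>) x = act X (Ide H (Dom H h), g) x'" by auto
      have x': "x' \<in> Fobj X (Dom H h, Dom G g)" using R(2)[of "Dom H h"] g(2) h(1) by auto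
      \<comment> \<open>\<open>[x, hy'] = [xh, y']\<close>: sliding \<open>h\<close> leaves a
        generator of \<open>Y\<close> on the right. Then \<open>xh = gx'\<close> brings a generator
        of \<open>X\<close> to the left, and \<open>g\<close> moves out of the bracket.\<close>
      have "w = bracket K H G X Y \<kappa> \<gamma> (Dom H h, act X (h, Ide G \<gamma>) x, y')"
        unfolding w y using bracket_slide[of \<kappa> \<gamma> h x y'] \<kappa> \<gamma> h(1,3) x(2) y' by simp
      also have "\<dots> = bracket K H G X Y \<kappa> \<gamma> (Dom H h, act X (Ide H (Dom H h), g) x', y')"
        unfolding x'' ..
      also have "\<dots> = act (tensor K H G X Y) (Ide K \<kappa>, g) (bracket K H G X Y \<kappa> (Dom G g) (Dom H h, x', y'))"
        using \<kappa> g(1,3) h(1) x' y' by simp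
      finally have "w = act (tensor K H G X Y) (Ide K \<kappa>, g) (bracket K H G X Y \<kappa> (Dom G g) (Dom H h, x', y'))" .
      moreover have "(Dom G g, bracket K H G X Y \<kappa> (Dom G g) (Dom H h, x', y')) \<in> Q"
        unfolding Q_def using g(2) h(2) by force
      ultimately show ?thesis using g(1,3) by blast
    qed
    ultimately show ?thesis
      unfolding T.finitely_generated_iff[OF \<kappa>]
      by (intro exI[of _ Q] conjI ballI gen)
  qed
  ultimately show ?thesis
    by (simp add: admissible_def is_biset_tensor)
qed

text \<open>Makes all rules for admissible bi-sets available for the product, which is what allows
  tensor products to be nested.\<close>

sublocale tensor: admissible_biset K G "tensor K H G X Y"
  by (intro admissible_bisetI admissible_tensor) unfold_locales

end

lemma biset_pairI:
  "\<lbrakk>groupoid K; groupoid H; groupoid G; admissible H G X; admissible K H Y\<rbrakk> \<Longrightarrow>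
    biset_pair K H G X Y"
  by (simp add: biset_pair_def admissible_bisetI)

section \<open>Horizontal composition, unitors and associator\<close>

lemma Fobj_unit_biset [simp]:
  "\<lbrakk>\<gamma>' \<in> Obj G; \<gamma> \<in> Obj G\<rbrakk> \<Longrightarrow> Fobj (unit_biset G) (\<gamma>', \<gamma>) = {f \<in> Arr G. Dom G f = \<gamma>' \<and> Cod G f = \<gamma>}"
  by (simp add: unit_biset_def hom_def)

lemma act_unit_biset [simp]:
  "\<lbrakk>h \<in> Arr G; g \<in> Arr G; f \<in> Arr G; Dom G f = Cod G h; Cod G f = Dom G g\<rbrakk> \<Longrightarrow>
    act (unit_biset G) (h, g) f = Comp G g (Comp G f h)"
  by (simp add: unit_biset_def act_def hom_def)

text \<open>Freeness is the cancellation of \<open>f\<close> in \<open>g f = g' f\<close>, possible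
  because \<open>f\<close> is invertible. Since \<open>f = f 1\<close>, the identity alone generates
  the left \<open>G\<close>-set of arrows out of a given object.\<close>

lemma admissible_unit_biset:
  assumes "groupoid G"
  shows "admissible G G (unit_biset G)"
proof -
  interpret G: groupoid G by fact
  interpret U: biset G G "unit_biset G"
  proof (unfold_locales, rule is_bisetI)
    fix h g x assume hg: "h \<in> Arr G" "g \<in> Arr G" "x \<in> Fobj (unit_biset G) (Cod G h, Dom G g)"
    then show "act (unit_biset G) (h, g) x \<in> Fobj (unit_biset G) (Dom G h, Cod G g)" by simp
    fix h' g' assume "h' \<in> Arr G" "g' \<in> Arr G" "Cod G h' = Dom G h" "Cod G g = Dom G g'"
    then show "act (unit_biset G) (Comp G h h', Comp G g' g) x =
        act (unit_biset G) (h', g') (act (unit_biset G) (h, g) x)"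
      using hg by (simp add: G.Comp_assoc')
  qed (auto simp: unit_biset_def hom_def act_def intro: G.category_axioms)
  have "g = g'"
    if f: "f \<in> Arr G" and g: "g \<in> Arr G" "g' \<in> Arr G" "Dom G g = Cod G f" "Dom G g' = Cod G f"
      and eq: "Comp G g f = Comp G g' f" for f g g'
  proof -
    obtain l where l: "l \<in> Arr G" "Dom G l = Cod G f" "Cod G l = Dom G f" "Comp G f l = Ide G (Cod G f)"
      using G.obtain_inverse[OF f] by metis
    have "Comp G (Comp G g f) l = Comp G (Comp G g' f) l" using eq by simp
    then show ?thesis using l f g by (simp add: G.Comp_assoc')
  qed
  then have "free_gset G (fix_upper G G (unit_biset G) \<gamma>)" if "\<gamma> \<in> Obj G" for \<gamma>
    using that unfolding U.free_gset_iff by auto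
  moreover have "finitely_generated G (fix_upper G G (unit_biset G) \<gamma>)" if "\<gamma> \<in> Obj G" for \<gamma>
    unfolding U.finitely_generated_iff[OF that]
    using that by (intro exI[of _ "{(\<gamma>, Ide G \<gamma>)}"]) auto
  ultimately show ?thesis using U.is_biset by (simp add: admissible_def)
qed

section \<open>Tensor products of 2-cells\<close>

locale tensor_maps = a: biset_map H G X X' a + b: biset_map K H Y Y' b
  for K H G :: "'u::infinite gpd" and X X' Y Y' :: "'u biset" and a b :: "'u biset_map"
begin

sublocale dom: biset_pair K H G X Y ..
sublocale cod: biset_pair K H G X' Y' ..

text \<open>Compatibility with slides is the equivariance of \<open>a\<close> and \<open>b\<close>:
  they carry a slide along \<open>h\<close> to a slide along the same \<open>h\<close>.\<close>

lemma app_tensor_map: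
  assumes "\<kappa> \<in> Obj K" "\<gamma> \<in> Obj G" "\<eta> \<in> Obj H" "x \<in> Fobj X (\<eta>, \<gamma>)" "y \<in> Fobj Y (\<kappa>, \<eta>)"
  shows "app (tensor_map K H G a b) \<kappa> \<gamma> (bracket K H G X Y \<kappa> \<gamma> (\<eta>, x, y)) =
    bracket K H G X' Y' \<kappa> \<gamma> (\<eta>, app a \<eta> \<gamma> x, app b \<kappa> \<eta> y)"
proof -
  let ?f = "\<lambda>(\<eta>, x, y). bracket K H G X' Y' \<kappa> \<gamma> (\<eta>, app a \<eta> \<gamma> x, app b \<kappa> \<eta> y)"
  have "bracket_map K H G X Y \<kappa> \<gamma> ?f (bracket K H G X Y \<kappa> \<gamma> (\<eta>, x, y)) = ?f (\<eta>, x, y)"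
    by (rule dom.bracket_map_bracket) (use assms in \<open>auto intro: cod.bracket_slide\<close>)
  then show ?thesis using assms by (simp add: tensor_map_def)
qed

text \<open>For injectivity, an arrow \<open>h\<close> that identifies two image brackets already
  identifies the original ones. Surjectivity lifts the two entries of a bracket separately.\<close>

lemma tensor_map_in_hom:
  "tensor_map K H G a b \<in> hom (biset_cat K G) (tensor K H G X Y) (tensor K H G X' Y')"
proof (rule in_hom_biset_catI)
  let ?t = "tensor_map K H G a b"
  fix \<kappa> \<gamma> assume k: "\<kappa> \<in> Obj K" "\<gamma> \<in> Obj G"
  show "src (amap ?t (\<kappa>, \<gamma>)) = Fobj (tensor K H G X Y) (\<kappa>, \<gamma>)"
    and "trg (amap ?t (\<kappa>, \<gamma>)) = Fobj (tensor K H G X' Y') (\<kappa>, \<gamma>)"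
    and "amap (amap ?t (\<kappa>, \<gamma>)) \<in> extensional (Fobj (tensor K H G X Y) (\<kappa>, \<gamma>))"
    using k by (simp_all add: tensor_map_def dom.bracket_map_ext)
  show "bij_betw (amap (amap ?t (\<kappa>, \<gamma>))) (Fobj (tensor K H G X Y) (\<kappa>, \<gamma>)) (Fobj (tensor K H G X' Y') (\<kappa>, \<gamma>))"
  proof (rule bij_betw_imageI)
    show "inj_on (amap (amap ?t (\<kappa>, \<gamma>))) (Fobj (tensor K H G X Y) (\<kappa>, \<gamma>))"
    proof (rule inj_onI)
      fix v w assume v: "v \<in> Fobj (tensor K H G X Y) (\<kappa>, \<gamma>)" and w: "w \<in> Fobj (tensor K H G X Y) (\<kappa>, \<gamma>)"
        and eq: "app ?t \<kappa> \<gamma> v = app ?t \<kappa> \<gamma> w"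
      obtain \<eta> x y where x: "\<eta> \<in> Obj H" "x \<in> Fobj X (\<eta>, \<gamma>)" "y \<in> Fobj Y (\<kappa>, \<eta>)"
        and v: "v = bracket K H G X Y \<kappa> \<gamma> (\<eta>, x, y)" using dom.bracket_cases[OF v k] .
      obtain \<eta>' x' y' where x': "\<eta>' \<in> Obj H" "x' \<in> Fobj X (\<eta>', \<gamma>)" "y' \<in> Fobj Y (\<kappa>, \<eta>')"
        and w: "w = bracket K H G X Y \<kappa> \<gamma> (\<eta>', x', y')" using dom.bracket_cases[OF w k] .
      from eq have "bracket K H G X' Y' \<kappa> \<gamma> (\<eta>, app a \<eta> \<gamma> x, app b \<kappa> \<eta> y) =
          bracket K H G X' Y' \<kappa> \<gamma> (\<eta>', app a \<eta>' \<gamma> x', app b \<kappa> \<eta>' y')"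
        using k x x' by (simp add: v w app_tensor_map)
      then obtain h where h: "h \<in> Arr H" "Dom H h = \<eta>" "Cod H h = \<eta>'"
        and e: "app a \<eta> \<gamma> x = act X' (h, Ide G \<gamma>) (app a \<eta>' \<gamma> x')"
          "app b \<kappa> \<eta>' y' = act Y' (Ide K \<kappa>, h) (app b \<kappa> \<eta> y)"
        by (rule cod.bracket_eqD) (use k x in auto)
      \<comment> \<open>By equivariance \<open>a x = (a x')h = a (x'h)\<close>, and the component of
        \<open>a\<close> is injective. The equation for \<open>y'\<close> arises in the same way
        from \<open>b\<close>.\<close>
      have x_eq: "x = act X (h, Ide G \<gamma>) x'"
        using a.app_eq_iff[of \<eta> \<gamma> x "act X (h, Ide G \<gamma>) x'"] e(1) h k x(1,2) x'(1,2) by simp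
      have y_eq: "y' = act Y (Ide K \<kappa>, h) y"
        using b.app_eq_iff[of \<kappa> \<eta>' y' "act Y (Ide K \<kappa>, h) y"] e(2) h k x(1,3) x'(1,3) by simp
      show "v = w"
        unfolding v w x_eq y_eq using dom.bracket_slide[of \<kappa> \<gamma> h x' y] h k x(1,3) x'(1,2) by simp
    qed
    show "amap (amap ?t (\<kappa>, \<gamma>)) ` Fobj (tensor K H G X Y) (\<kappa>, \<gamma>) = Fobj (tensor K H G X' Y') (\<kappa>, \<gamma>)"
    proof (intro equalityI subsetI)
      fix w assume "w \<in> amap (amap ?t (\<kappa>, \<gamma>)) ` Fobj (tensor K H G X Y) (\<kappa>, \<gamma>)"
      then show "w \<in> Fobj (tensor K H G X' Y') (\<kappa>, \<gamma>)"
        using k by (auto simp: app_tensor_map elim!: dom.bracket_cases)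
    next
      fix w assume "w \<in> Fobj (tensor K H G X' Y') (\<kappa>, \<gamma>)"
      then obtain \<eta> x' y' where x': "\<eta> \<in> Obj H" "x' \<in> Fobj X' (\<eta>, \<gamma>)" "y' \<in> Fobj Y' (\<kappa>, \<eta>)"
        and w: "w = bracket K H G X' Y' \<kappa> \<gamma> (\<eta>, x', y')" using cod.bracket_cases k by blast
      obtain x where x: "x \<in> Fobj X (\<eta>, \<gamma>)" "x' = app a \<eta> \<gamma> x"
        using a.app_surj[of \<eta> \<gamma> x'] x' k by blast
      obtain y where y: "y \<in> Fobj Y (\<kappa>, \<eta>)" "y' = app b \<kappa> \<eta> y"
        using b.app_surj[of \<kappa> \<eta> y'] x' k by blast
      show "w \<in> amap (amap ?t (\<kappa>, \<gamma>)) ` Fobj (tensor K H G X Y) (\<kappa>, \<gamma>)"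
        using x y x'(1) k
        by (intro image_eqI[of _ _ "bracket K H G X Y \<kappa> \<gamma> (\<eta>, x, y)"]) (simp_all add: w app_tensor_map)
    qed
  qed
next
  fix k g w assume kg: "k \<in> Arr K" "g \<in> Arr G" and w: "w \<in> Fobj (tensor K H G X Y) (Cod K k, Dom G g)"
  obtain \<eta> x y where "\<eta> \<in> Obj H" "x \<in> Fobj X (\<eta>, Dom G g)" "y \<in> Fobj Y (Cod K k, \<eta>)"
    and "w = bracket K H G X Y (Cod K k) (Dom G g) (\<eta>, x, y)"
    using dom.bracket_cases[OF w] kg by auto
  then show "app (tensor_map K H G a b) (Dom K k) (Cod G g) (act (tensor K H G X Y) (k, g) w) =
      act (tensor K H G X' Y') (k, g) (app (tensor_map K H G a b) (Cod K k) (Dom G g) w)"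
    using kg by (simp add: app_tensor_map)
next
  show "groupoid K" "groupoid G" by unfold_locales
qed (simp_all add: tensor_map_def dom.admissible_tensor cod.admissible_tensor)

end

lemma tensor_mapsI:
  "\<lbrakk>groupoid K; groupoid H; groupoid G; a \<in> hom (biset_cat H G) X X'; b \<in> hom (biset_cat K H) Y Y'\<rbrakk> \<Longrightarrow>
    tensor_maps K H G X X' Y Y' a b"
  by (simp add: tensor_maps_def biset_mapI)

section \<open>The unitors\<close>

locale unitors = X: admissible_biset H G X
  for H G :: "'u::infinite gpd" and X :: "'u biset"
begin

sublocale right_unit: biset_pair H H G X "unit_biset H"
  by (intro biset_pairI X.H.groupoid_axioms X.G.groupoid_axioms X.admissible admissible_unit_biset)

sublocale left_unit: biset_pair H G G "unit_biset G" X
  by (intro biset_pairI X.H.groupoid_axioms X.G.groupoid_axioms X.admissible admissible_unit_biset)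

text \<open>Compatible with slides because \<open>(xk)h = x(kh)\<close> and \<open>k\<close> acts on
  the unit bi-set by composition.\<close>

lemma app_right_unitor [simp]:
  assumes "\<eta> \<in> Obj H" "\<gamma> \<in> Obj G" "h \<in> Arr H" "Dom H h = \<eta>" "Cod H h = \<eta>'" "x \<in> Fobj X (\<eta>', \<gamma>)"
  shows "app (right_unitor H G X) \<eta> \<gamma> (bracket H H G X (unit_biset H) \<eta> \<gamma> (\<eta>', x, h)) =
    act X (h, Ide G \<gamma>) x"
proof -
  let ?f = "\<lambda>(\<eta>', x, h). act X (h, Ide G \<gamma>) x"
  have "bracket_map H H G X (unit_biset H) \<eta> \<gamma> ?f
      (bracket H H G X (unit_biset H) \<eta> \<gamma> (\<eta>', x, h)) = ?f (\<eta>', x, h)"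
    by (rule right_unit.bracket_map_bracket) (use assms in auto)
  then show ?thesis using assms by (simp add: right_unitor_def)
qed

lemma app_left_unitor [simp]:
  assumes "\<eta> \<in> Obj H" "\<gamma> \<in> Obj G" "g \<in> Arr G" "Dom G g = \<gamma>'" "Cod G g = \<gamma>" "x \<in> Fobj X (\<eta>, \<gamma>')"
  shows "app (left_unitor H G X) \<eta> \<gamma> (bracket H G G (unit_biset G) X \<eta> \<gamma> (\<gamma>', g, x)) =
    act X (Ide H \<eta>, g) x"
proof -
  let ?f = "\<lambda>(\<gamma>', g, x). act X (Ide H \<eta>, g) x"
  have "bracket_map H G G (unit_biset G) X \<eta> \<gamma> ?f
      (bracket H G G (unit_biset G) X \<eta> \<gamma> (\<gamma>', g, x)) = ?f (\<gamma>', g, x)"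
    by (rule left_unit.bracket_map_bracket) (use assms in auto)
  then show ?thesis using assms by (simp add: left_unitor_def)
qed

text \<open>Every \<open>[x, h]\<close> equals \<open>[xh, 1]\<close>, which is what makes the right unitor injective.\<close>

lemma right_unit_cases:
  assumes "w \<in> Fobj (tensor H H G X (unit_biset H)) (\<eta>, \<gamma>)" "\<eta> \<in> Obj H" "\<gamma> \<in> Obj G"
  obtains x where "x \<in> Fobj X (\<eta>, \<gamma>)" "w = bracket H H G X (unit_biset H) \<eta> \<gamma> (\<eta>, x, Ide H \<eta>)"
proof -
  obtain \<eta>' x h where x: "\<eta>' \<in> Obj H" "x \<in> Fobj X (\<eta>', \<gamma>)" "h \<in> Fobj (unit_biset H) (\<eta>, \<eta>')"
    and w: "w = bracket H H G X (unit_biset H) \<eta> \<gamma> (\<eta>', x, h)"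
    using right_unit.bracket_cases[OF assms] .
  \<comment> \<open>The slide of \<open>h\<close> reads \<open>[xh, 1] = [x, h 1]\<close>.\<close>
  show thesis
    using right_unit.bracket_slide[of \<eta> \<gamma> h x "Ide H \<eta>"] x assms
    by (intro that[of "act X (h, Ide G \<gamma>) x"]) (auto simp: w)
qed

text \<open>Here the slide of \<open>g\<close> reads \<open>[1 g, x] = [1, gx]\<close>, so the
  group-like factor can be absorbed into \<open>x\<close>.\<close>

lemma left_unit_cases:
  assumes "w \<in> Fobj (tensor H G G (unit_biset G) X) (\<eta>, \<gamma>)" "\<eta> \<in> Obj H" "\<gamma> \<in> Obj G"
  obtains x where "x \<in> Fobj X (\<eta>, \<gamma>)" "w = bracket H G G (unit_biset G) X \<eta> \<gamma> (\<gamma>, Ide G \<gamma>, x)"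
proof -
  obtain \<gamma>' g x where x: "\<gamma>' \<in> Obj G" "g \<in> Fobj (unit_biset G) (\<gamma>', \<gamma>)" "x \<in> Fobj X (\<eta>, \<gamma>')"
    and w: "w = bracket H G G (unit_biset G) X \<eta> \<gamma> (\<gamma>', g, x)"
    using left_unit.bracket_cases[OF assms] .
  show thesis
    using left_unit.bracket_slide[of \<eta> \<gamma> g "Ide G \<gamma>" x] x assms
    by (intro that[of "act X (Ide H \<eta>, g) x"]) (auto simp: w)
qed

lemma right_unitor_in_hom:
  "right_unitor H G X \<in> hom (biset_cat H G) (tensor H H G X (unit_biset H)) X"
proof (rule in_hom_biset_catI)
  let ?r = "right_unitor H G X" and ?T = "tensor H H G X (unit_biset H)"
  fix \<eta> \<gamma> assume k: "\<eta> \<in> Obj H" "\<gamma> \<in> Obj G"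
  show "src (amap ?r (\<eta>, \<gamma>)) = Fobj ?T (\<eta>, \<gamma>)" "trg (amap ?r (\<eta>, \<gamma>)) = Fobj X (\<eta>, \<gamma>)"
    "amap (amap ?r (\<eta>, \<gamma>)) \<in> extensional (Fobj ?T (\<eta>, \<gamma>))"
    using k by (simp_all add: right_unitor_def right_unit.bracket_map_ext)
  show "bij_betw (amap (amap ?r (\<eta>, \<gamma>))) (Fobj ?T (\<eta>, \<gamma>)) (Fobj X (\<eta>, \<gamma>))"
    \<comment> \<open>The inverse sends \<open>x\<close> to \<open>[x, 1]\<close>. It is defined on
      \<open>X\<close> itself and not on a co-end, hence free of any compatibility
      condition.\<close>
    by (rule bij_betw_byWitness[where f' = "\<lambda>x. bracket H H G X (unit_biset H) \<eta> \<gamma> (\<eta>, x, Ide H \<eta>)"])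
      (use k in \<open>auto elim!: right_unit_cases\<close>)
next
  fix h g w assume hg: "h \<in> Arr H" "g \<in> Arr G"
    and w: "w \<in> Fobj (tensor H H G X (unit_biset H)) (Cod H h, Dom G g)"
  obtain x where "x \<in> Fobj X (Cod H h, Dom G g)"
    "w = bracket H H G X (unit_biset H) (Cod H h) (Dom G g) (Cod H h, x, Ide H (Cod H h))"
    using right_unit_cases[OF w] hg by auto
  then show "app (right_unitor H G X) (Dom H h) (Cod G g) (act (tensor H H G X (unit_biset H)) (h, g) w) =
      act X (h, g) (app (right_unitor H G X) (Cod H h) (Dom G g) w)"
    using hg by simp
next
  show "groupoid H" "groupoid G" by unfold_locales
qed (simp_all add: right_unitor_def right_unit.admissible_tensor X.admissible)

lemma left_unitor_in_hom:
  "left_unitor H G X \<in> hom (biset_cat H G) (tensor H G G (unit_biset G) X) X"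
proof (rule in_hom_biset_catI)
  let ?l = "left_unitor H G X" and ?T = "tensor H G G (unit_biset G) X"
  fix \<eta> \<gamma> assume k: "\<eta> \<in> Obj H" "\<gamma> \<in> Obj G"
  show "src (amap ?l (\<eta>, \<gamma>)) = Fobj ?T (\<eta>, \<gamma>)" "trg (amap ?l (\<eta>, \<gamma>)) = Fobj X (\<eta>, \<gamma>)"
    "amap (amap ?l (\<eta>, \<gamma>)) \<in> extensional (Fobj ?T (\<eta>, \<gamma>))"
    using k by (simp_all add: left_unitor_def left_unit.bracket_map_ext)
  show "bij_betw (amap (amap ?l (\<eta>, \<gamma>))) (Fobj ?T (\<eta>, \<gamma>)) (Fobj X (\<eta>, \<gamma>))"
    by (rule bij_betw_byWitness[where f' = "\<lambda>x. bracket H G G (unit_biset G) X \<eta> \<gamma> (\<gamma>, Ide G \<gamma>, x)"])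
      (use k in \<open>auto elim!: left_unit_cases\<close>)
next
  fix h g w assume hg: "h \<in> Arr H" "g \<in> Arr G"
    and w: "w \<in> Fobj (tensor H G G (unit_biset G) X) (Cod H h, Dom G g)"
  obtain x where "x \<in> Fobj X (Cod H h, Dom G g)"
    "w = bracket H G G (unit_biset G) X (Cod H h) (Dom G g) (Dom G g, Ide G (Dom G g), x)"
    using left_unit_cases[OF w] hg by auto
  then show "app (left_unitor H G X) (Dom H h) (Cod G g) (act (tensor H G G (unit_biset G) X) (h, g) w) =
      act X (h, g) (app (left_unitor H G X) (Cod H h) (Dom G g) w)"
    using hg by simp
next
  show "groupoid H" "groupoid G" by unfold_locales
qed (simp_all add: left_unitor_def left_unit.admissible_tensor X.admissible)

end

section \<open>The associator\<close>

locale biset_triple =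
  X: admissible_biset G L X + Y: admissible_biset H G Y + Z: admissible_biset K H Z
  for K H G L :: "'u::infinite gpd" and X Y Z :: "'u biset"
begin

sublocale XY: biset_pair H G L X Y ..
sublocale YZ: biset_pair K H G Y Z ..
sublocale X_YZ: biset_pair K G L X "tensor K H G Y Z" ..
sublocale XY_Z: biset_pair K H L "tensor H G L X Y" Z ..

text \<open>The defining formula evaluates a map out of \<open>Y \<otimes> Z\<close> inside a map
  out of \<open>X \<otimes> (Y \<otimes> Z)\<close>, so compatibility is checked twice: along
  \<open>H\<close> for fixed \<open>x\<close>, then along \<open>G\<close>.\<close>

lemma app_associator:
  assumes "\<kappa> \<in> Obj K" "\<eta> \<in> Obj H" "\<gamma> \<in> Obj G" "\<zeta> \<in> Obj L"
    and "x \<in> Fobj X (\<gamma>, \<zeta>)" "y \<in> Fobj Y (\<eta>, \<gamma>)" "z \<in> Fobj Z (\<kappa>, \<eta>)"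
  shows "app (associator K H G L X Y Z) \<kappa> \<zeta>
      (bracket K G L X (tensor K H G Y Z) \<kappa> \<zeta> (\<gamma>, x, bracket K H G Y Z \<kappa> \<gamma> (\<eta>, y, z))) =
    bracket K H L (tensor H G L X Y) Z \<kappa> \<zeta> (\<eta>, bracket H G L X Y \<eta> \<zeta> (\<gamma>, x, y), z)"
proof -
  let ?e = "\<lambda>\<gamma> x (\<eta>, y, z). bracket K H L (tensor H G L X Y) Z \<kappa> \<zeta>
    (\<eta>, bracket H G L X Y \<eta> \<zeta> (\<gamma>, x, y), z)"
  let ?f = "\<lambda>(\<gamma>, x, w). bracket_map K H G Y Z \<kappa> \<gamma> (?e \<gamma> x) w"
  \<comment> \<open>Compatibility along \<open>H\<close>:
    \<open>[[x, yh], z] = [[x, y]h, z] = [[x, y], hz]\<close>. It is proved for arbitrary \<gamma>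
    and \<open>x\<close>, because the outer check evaluates it at both ends of an arrow of
    \<open>G\<close>.\<close>
  have inner: "bracket_map K H G Y Z \<kappa> \<gamma> (?e \<gamma> x) (bracket K H G Y Z \<kappa> \<gamma> (\<eta>, y, z)) = ?e \<gamma> x (\<eta>, y, z)"
    if "\<eta> \<in> Obj H" "\<gamma> \<in> Obj G" "x \<in> Fobj X (\<gamma>, \<zeta>)" "y \<in> Fobj Y (\<eta>, \<gamma>)" "z \<in> Fobj Z (\<kappa>, \<eta>)"
    for \<eta> \<gamma> x y z
  proof (rule YZ.bracket_map_bracket)
    fix h y z assume "h \<in> Arr H" "y \<in> Fobj Y (Cod H h, \<gamma>)" "z \<in> Fobj Z (\<kappa>, Dom H h)"
    then show "?e \<gamma> x (Dom H h, act Y (h, Ide G \<gamma>) y, z) = ?e \<gamma> x (Cod H h, y, act Z (Ide K \<kappa>, h) z)"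
      using that assms(1,4)
        XY_Z.bracket_slide[of \<kappa> \<zeta> h "bracket H G L X Y (Cod H h) \<zeta> (\<gamma>, x, y)" z] by simp
  qed (use that assms in auto)
  have "bracket_map K G L X (tensor K H G Y Z) \<kappa> \<zeta> ?f (bracket K G L X (tensor K H G Y Z) \<kappa> \<zeta>
      (\<gamma>, x, bracket K H G Y Z \<kappa> \<gamma> (\<eta>, y, z))) = ?f (\<gamma>, x, bracket K H G Y Z \<kappa> \<gamma> (\<eta>, y, z))"
  proof (rule X_YZ.bracket_map_bracket)
    fix g x w assume g: "g \<in> Arr G" "x \<in> Fobj X (Cod G g, \<zeta>)"
      and w: "w \<in> Fobj (tensor K H G Y Z) (\<kappa>, Dom G g)"
    obtain \<eta> y z where y: "\<eta> \<in> Obj H" "y \<in> Fobj Y (\<eta>, Dom G g)" "z \<in> Fobj Z (\<kappa>, \<eta>)"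
      and w: "w = bracket K H G Y Z \<kappa> (Dom G g) (\<eta>, y, z)"
      using YZ.bracket_cases[OF w] assms g by auto
    \<comment> \<open>With \<open>w = [y, z]\<close> this is
      \<open>[[xg, y], z] = [[x, gy], z]\<close>, a slide inside the left factor.\<close>
    show "?f (Dom G g, act X (g, Ide L \<zeta>) x, w) = ?f (Cod G g, x, act (tensor K H G Y Z) (Ide K \<kappa>, g) w)"
      using g y assms(1,4) XY.bracket_slide[of \<eta> \<zeta> g x y]
      by (simp add: w inner del: YZ.bracket_set_eq)
  qed (use assms in auto)
  also have "\<dots> = ?e \<gamma> x (\<eta>, y, z)" using assms by (simp add: inner)
  finally show ?thesis using assms by (simp add: associator_def)
qed

lemma X_YZ_cases:
  assumes "v \<in> Fobj (tensor K G L X (tensor K H G Y Z)) (\<kappa>, \<zeta>)" "\<kappa> \<in> Obj K" "\<zeta> \<in> Obj L"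
  obtains \<gamma> \<eta> x y z where "\<gamma> \<in> Obj G" "\<eta> \<in> Obj H" "x \<in> Fobj X (\<gamma>, \<zeta>)" "y \<in> Fobj Y (\<eta>, \<gamma>)"
    "z \<in> Fobj Z (\<kappa>, \<eta>)"
    "v = bracket K G L X (tensor K H G Y Z) \<kappa> \<zeta> (\<gamma>, x, bracket K H G Y Z \<kappa> \<gamma> (\<eta>, y, z))"
proof -
  obtain \<gamma> x w where x: "\<gamma> \<in> Obj G" "x \<in> Fobj X (\<gamma>, \<zeta>)" "w \<in> Fobj (tensor K H G Y Z) (\<kappa>, \<gamma>)"
    and v: "v = bracket K G L X (tensor K H G Y Z) \<kappa> \<zeta> (\<gamma>, x, w)"
    using X_YZ.bracket_cases[OF assms] .
  show thesis using YZ.bracket_cases[OF x(3) assms(2) x(1)] x that v by metis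
qed

text \<open>Injectivity takes apart an equality of double brackets from the outside in. The outer
  level yields an arrow \<open>h\<close> of \<open>H\<close>, the inner level an arrow
  \<open>g\<close> of \<open>G\<close>, and sliding \<open>g\<close> and then \<open>h\<close>
  identifies the two preimages.\<close>

lemma associator_in_hom:
  "associator K H G L X Y Z \<in> hom (biset_cat K L)
    (tensor K G L X (tensor K H G Y Z)) (tensor K H L (tensor H G L X Y) Z)"
proof (rule in_hom_biset_catI)
  let ?a = "associator K H G L X Y Z"
  let ?S = "tensor K G L X (tensor K H G Y Z)" and ?T = "tensor K H L (tensor H G L X Y) Z"
  fix \<kappa> \<zeta> assume k: "\<kappa> \<in> Obj K" "\<zeta> \<in> Obj L"
  show "src (amap ?a (\<kappa>, \<zeta>)) = Fobj ?S (\<kappa>, \<zeta>)" "trg (amap ?a (\<kappa>, \<zeta>)) = Fobj ?T (\<kappa>, \<zeta>)"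
    "amap (amap ?a (\<kappa>, \<zeta>)) \<in> extensional (Fobj ?S (\<kappa>, \<zeta>))"
    using k by (simp_all add: associator_def X_YZ.bracket_map_ext)
  show "bij_betw (amap (amap ?a (\<kappa>, \<zeta>))) (Fobj ?S (\<kappa>, \<zeta>)) (Fobj ?T (\<kappa>, \<zeta>))"
  proof (rule bij_betw_imageI)
    show "inj_on (amap (amap ?a (\<kappa>, \<zeta>))) (Fobj ?S (\<kappa>, \<zeta>))"
    proof (rule inj_onI)
      fix v v' assume v: "v \<in> Fobj ?S (\<kappa>, \<zeta>)" and v': "v' \<in> Fobj ?S (\<kappa>, \<zeta>)"
        and eq: "app ?a \<kappa> \<zeta> v = app ?a \<kappa> \<zeta> v'"
      obtain \<gamma> \<eta> x y z where x: "\<gamma> \<in> Obj G" "\<eta> \<in> Obj H" "x \<in> Fobj X (\<gamma>, \<zeta>)" "y \<in> Fobj Y (\<eta>, \<gamma>)"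
          "z \<in> Fobj Z (\<kappa>, \<eta>)"
        and v: "v = bracket K G L X (tensor K H G Y Z) \<kappa> \<zeta> (\<gamma>, x, bracket K H G Y Z \<kappa> \<gamma> (\<eta>, y, z))"
        using X_YZ_cases[OF v k] .
      obtain \<gamma>' \<eta>' x' y' z' where x': "\<gamma>' \<in> Obj G" "\<eta>' \<in> Obj H" "x' \<in> Fobj X (\<gamma>', \<zeta>)"
          "y' \<in> Fobj Y (\<eta>', \<gamma>')" "z' \<in> Fobj Z (\<kappa>, \<eta>')"
        and v': "v' = bracket K G L X (tensor K H G Y Z) \<kappa> \<zeta>
          (\<gamma>', x', bracket K H G Y Z \<kappa> \<gamma>' (\<eta>', y', z'))"
        using X_YZ_cases[OF v' k] .
      have "bracket K H L (tensor H G L X Y) Z \<kappa> \<zeta> (\<eta>, bracket H G L X Y \<eta> \<zeta> (\<gamma>, x, y), z) =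
          bracket K H L (tensor H G L X Y) Z \<kappa> \<zeta> (\<eta>', bracket H G L X Y \<eta>' \<zeta> (\<gamma>', x', y'), z')"
        using eq k x x' by (simp add: v v' app_associator)
      then obtain h where h: "h \<in> Arr H" "Dom H h = \<eta>" "Cod H h = \<eta>'"
        and xy: "bracket H G L X Y \<eta> \<zeta> (\<gamma>, x, y) =
          act (tensor H G L X Y) (h, Ide L \<zeta>) (bracket H G L X Y \<eta>' \<zeta> (\<gamma>', x', y'))"
        and z': "z' = act Z (Ide K \<kappa>, h) z"
        by (rule XY_Z.bracket_eqD) (use k x in auto)
      \<comment> \<open>The arrow \<open>h\<close> acts on a product through its right factor:
        \<open>[x', y']h = [x', y'h]\<close>.\<close>
      have "bracket H G L X Y \<eta> \<zeta> (\<gamma>, x, y) =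
          bracket H G L X Y \<eta> \<zeta> (\<gamma>', x', act Y (h, Ide G \<gamma>') y')"
        unfolding xy using k h x'(1-4) by simp
      then obtain g where g: "g \<in> Arr G" "Dom G g = \<gamma>" "Cod G g = \<gamma>'"
        and x_eq: "x = act X (g, Ide L \<zeta>) x'"
        and y_eq: "act Y (h, Ide G \<gamma>') y' = act Y (Ide H \<eta>, g) y"
        by (rule XY.bracket_eqD) (use k x in auto)
      \<comment> \<open>The chain is \<open>[x'g, [y, z]] = [x', [gy, z]] = [x', [y'h, z]] = [x',
        [y', hz]]\<close>, with \<open>gy = y'h\<close> in the middle.\<close>
      have "v = bracket K G L X (tensor K H G Y Z) \<kappa> \<zeta>
          (\<gamma>', x', act (tensor K H G Y Z) (Ide K \<kappa>, g) (bracket K H G Y Z \<kappa> \<gamma> (\<eta>, y, z)))"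
        unfolding v x_eq
        using X_YZ.bracket_slide[of \<kappa> \<zeta> g x' "bracket K H G Y Z \<kappa> \<gamma> (\<eta>, y, z)"] g k x(1,2,4,5) x'(1,3)
        by simp
      also have "\<dots> = bracket K G L X (tensor K H G Y Z) \<kappa> \<zeta>
          (\<gamma>', x', bracket K H G Y Z \<kappa> \<gamma>' (\<eta>, act Y (Ide H \<eta>, g) y, z))"
        using g k x(1,2,4,5) by simp
      also have "\<dots> = v'"
        unfolding v' z' y_eq[symmetric]
        using YZ.bracket_slide[of \<kappa> \<gamma>' h y' z] h k x(1,2,5) x'(1,2,4) by simp
      finally show "v = v'" .
    qed
    show "amap (amap ?a (\<kappa>, \<zeta>)) ` Fobj ?S (\<kappa>, \<zeta>) = Fobj ?T (\<kappa>, \<zeta>)"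
    proof (intro equalityI subsetI)
      fix v assume "v \<in> amap (amap ?a (\<kappa>, \<zeta>)) ` Fobj ?S (\<kappa>, \<zeta>)"
      then show "v \<in> Fobj ?T (\<kappa>, \<zeta>)"
        using k by (auto simp: app_associator elim!: X_YZ_cases)
    next
      fix v assume v: "v \<in> Fobj ?T (\<kappa>, \<zeta>)"
      obtain \<eta> w z where w: "\<eta> \<in> Obj H" "w \<in> Fobj (tensor H G L X Y) (\<eta>, \<zeta>)" "z \<in> Fobj Z (\<kappa>, \<eta>)"
        and v: "v = bracket K H L (tensor H G L X Y) Z \<kappa> \<zeta> (\<eta>, w, z)"
        using XY_Z.bracket_cases[OF v k] .
      obtain \<gamma> x y where x: "\<gamma> \<in> Obj G" "x \<in> Fobj X (\<gamma>, \<zeta>)" "y \<in> Fobj Y (\<eta>, \<gamma>)"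
        and w_eq: "w = bracket H G L X Y \<eta> \<zeta> (\<gamma>, x, y)"
        using XY.bracket_cases[OF w(2,1) k(2)] .
      show "v \<in> amap (amap ?a (\<kappa>, \<zeta>)) ` Fobj ?S (\<kappa>, \<zeta>)"
        using k x w(1,3)
        by (intro image_eqI[of _ _ "bracket K G L X (tensor K H G Y Z) \<kappa> \<zeta>
              (\<gamma>, x, bracket K H G Y Z \<kappa> \<gamma> (\<eta>, y, z))"])
          (simp_all add: v w_eq app_associator)
    qed
  qed
next
  fix k l v assume kl: "k \<in> Arr K" "l \<in> Arr L"
    and v: "v \<in> Fobj (tensor K G L X (tensor K H G Y Z)) (Cod K k, Dom L l)"
  have "Cod K k \<in> Obj K" "Dom L l \<in> Obj L" using kl by simp_all
  then obtain \<gamma> \<eta> x y z where "\<gamma> \<in> Obj G" "\<eta> \<in> Obj H" "x \<in> Fobj X (\<gamma>, Dom L l)" "y \<in> Fobj Y (\<eta>, \<gamma>)"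
      "z \<in> Fobj Z (Cod K k, \<eta>)"
    and "v = bracket K G L X (tensor K H G Y Z) (Cod K k) (Dom L l)
      (\<gamma>, x, bracket K H G Y Z (Cod K k) \<gamma> (\<eta>, y, z))"
    by (rule X_YZ_cases[OF v])
  then show "app (associator K H G L X Y Z) (Dom K k) (Cod L l)
      (act (tensor K G L X (tensor K H G Y Z)) (k, l) v) =
    act (tensor K H L (tensor H G L X Y) Z) (k, l) (app (associator K H G L X Y Z) (Cod K k) (Dom L l) v)"
    using kl by (simp add: app_associator)
next
  show "groupoid K" "groupoid L" by unfold_locales
qed (simp_all add: associator_def X_YZ.admissible_tensor XY_Z.admissible_tensor)

end

lemma biset_tripleI:
  "\<lbrakk>groupoid K; groupoid H; groupoid G; groupoid L; admissible G L X; admissible H G Y;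
    admissible K H Z\<rbrakk> \<Longrightarrow> biset_triple K H G L X Y Z"
  by (simp add: biset_triple_def admissible_bisetI)

section \<open>Functoriality, naturality and coherence\<close>

lemma tensor_map_Ide:
  assumes "groupoid K" "groupoid H" "groupoid G" "admissible H G X" "admissible K H Y"
  shows "tensor_map K H G (Ide (biset_cat H G) X) (Ide (biset_cat K H) Y) =
    Ide (biset_cat K G) (tensor K H G X Y)"
proof -
  interpret tensor_maps K H G X X Y Y "Ide (biset_cat H G) X" "Ide (biset_cat K H) Y"
    using assms by (intro tensor_mapsI Ide_in_hom)
  show ?thesis
  proof (rule biset_map_eqI[OF assms(1,3) tensor_map_in_hom Ide_in_hom[OF assms(1,3)]])
    fix \<kappa> \<gamma> w assume k: "\<kappa> \<in> Obj K" "\<gamma> \<in> Obj G" and w: "w \<in> Fobj (tensor K H G X Y) (\<kappa>, \<gamma>)"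
    show "app (tensor_map K H G (Ide (biset_cat H G) X) (Ide (biset_cat K H) Y)) \<kappa> \<gamma> w =
        app (Ide (biset_cat K G) (tensor K H G X Y)) \<kappa> \<gamma> w"
      using k by (cases rule: dom.bracket_cases[OF w k]) (simp add: app_tensor_map)
  qed (rule dom.admissible_tensor)
qed

text \<open>The interchange law: on a bracket both sides apply the two composites entry by
  entry.\<close>

lemma tensor_map_Comp:
  assumes gpd: "groupoid K" "groupoid H" "groupoid G"
    and a: "a \<in> hom (biset_cat H G) X X'" "a' \<in> hom (biset_cat H G) X' X''"
    and b: "b \<in> hom (biset_cat K H) Y Y'" "b' \<in> hom (biset_cat K H) Y' Y''"
  shows "tensor_map K H G (Comp (biset_cat H G) a' a) (Comp (biset_cat K H) b' b) =
    Comp (biset_cat K G) (tensor_map K H G a' b') (tensor_map K H G a b)"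
proof -
  interpret p1: tensor_maps K H G X X' Y Y' a b using gpd a b by (intro tensor_mapsI)
  interpret p2: tensor_maps K H G X' X'' Y' Y'' a' b' using gpd a b by (intro tensor_mapsI)
  interpret p3: tensor_maps K H G X X'' Y Y'' "Comp (biset_cat H G) a' a" "Comp (biset_cat K H) b' b"
    using gpd a b by (intro tensor_mapsI Comp_in_hom)
  note Comp = app_Comp[OF gpd(2,3) a] app_Comp[OF gpd(1,2) b]
    app_Comp[OF gpd(1,3) p1.tensor_map_in_hom p2.tensor_map_in_hom]
  show ?thesis
  proof (rule biset_map_eqI[OF gpd(1,3) p3.tensor_map_in_hom
        Comp_in_hom[OF gpd(1,3) p1.tensor_map_in_hom p2.tensor_map_in_hom]])
    fix \<kappa> \<gamma> w assume k: "\<kappa> \<in> Obj K" "\<gamma> \<in> Obj G" and w: "w \<in> Fobj (tensor K H G X Y) (\<kappa>, \<gamma>)"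
    show "app (tensor_map K H G (Comp (biset_cat H G) a' a) (Comp (biset_cat K H) b' b)) \<kappa> \<gamma> w =
        app (Comp (biset_cat K G) (tensor_map K H G a' b') (tensor_map K H G a b)) \<kappa> \<gamma> w"
      using k by (cases rule: p1.dom.bracket_cases[OF w k])
        (simp add: Comp p1.app_tensor_map p2.app_tensor_map p3.app_tensor_map)
  qed
qed

text \<open>It suffices to test elements \<open>[x, 1]\<close>. The tensor map sends such an element
  to \<open>[a x, 1]\<close>, and both sides take the value \<open>a x\<close>.\<close>

lemma right_unitor_natural:
  assumes gpd: "groupoid H" "groupoid G" and a: "a \<in> hom (biset_cat H G) X X'"
  shows "Comp (biset_cat H G) (right_unitor H G X')
      (tensor_map H H G a (Ide (biset_cat H H) (unit_biset H))) =
    Comp (biset_cat H G) a (right_unitor H G X)"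
proof -
  let ?i = "Ide (biset_cat H H) (unit_biset H)"
  interpret a: biset_map H G X X' a using gpd a by (intro biset_mapI)
  interpret X: unitors H G X ..
  interpret X': unitors H G X' ..
  interpret tensor_maps H H G X X' "unit_biset H" "unit_biset H" a ?i
    using gpd a by (intro tensor_mapsI Ide_in_hom admissible_unit_biset)
  note homs = tensor_map_in_hom X.right_unitor_in_hom X'.right_unitor_in_hom
  show ?thesis
  proof (rule biset_map_eqI[OF gpd Comp_in_hom[OF gpd homs(1,3)] Comp_in_hom[OF gpd homs(2) a]])
    fix \<eta> \<gamma> w
    assume k: "\<eta> \<in> Obj H" "\<gamma> \<in> Obj G" and w: "w \<in> Fobj (tensor H H G X (unit_biset H)) (\<eta>, \<gamma>)"
    show "app (Comp (biset_cat H G) (right_unitor H G X') (tensor_map H H G a ?i)) \<eta> \<gamma> w =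
        app (Comp (biset_cat H G) a (right_unitor H G X)) \<eta> \<gamma> w"
      using k by (cases rule: X.right_unit_cases[OF w k])
        (simp add: app_Comp[OF gpd homs(1,3)] app_Comp[OF gpd homs(2) a] app_tensor_map)
  qed
qed

lemma left_unitor_natural:
  assumes gpd: "groupoid H" "groupoid G" and a: "a \<in> hom (biset_cat H G) X X'"
  shows "Comp (biset_cat H G) (left_unitor H G X')
      (tensor_map H G G (Ide (biset_cat G G) (unit_biset G)) a) =
    Comp (biset_cat H G) a (left_unitor H G X)"
proof -
  let ?i = "Ide (biset_cat G G) (unit_biset G)"
  interpret a: biset_map H G X X' a using gpd a by (intro biset_mapI)
  interpret X: unitors H G X ..
  interpret X': unitors H G X' ..
  interpret tensor_maps H G G "unit_biset G" "unit_biset G" X X' ?i a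
    using gpd a by (intro tensor_mapsI Ide_in_hom admissible_unit_biset)
  note homs = tensor_map_in_hom X.left_unitor_in_hom X'.left_unitor_in_hom
  show ?thesis
  proof (rule biset_map_eqI[OF gpd Comp_in_hom[OF gpd homs(1,3)] Comp_in_hom[OF gpd homs(2) a]])
    fix \<eta> \<gamma> w
    assume k: "\<eta> \<in> Obj H" "\<gamma> \<in> Obj G" and w: "w \<in> Fobj (tensor H G G (unit_biset G) X) (\<eta>, \<gamma>)"
    show "app (Comp (biset_cat H G) (left_unitor H G X') (tensor_map H G G ?i a)) \<eta> \<gamma> w =
        app (Comp (biset_cat H G) a (left_unitor H G X)) \<eta> \<gamma> w"
      using k by (cases rule: X.left_unit_cases[OF w k])
        (simp add: app_Comp[OF gpd homs(1,3)] app_Comp[OF gpd homs(2) a] app_tensor_map)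
  qed
qed

text \<open>Both sides send \<open>[x, [y, z]]\<close> to \<open>[[a x, b y], c z]\<close>.\<close>

lemma associator_natural:
  assumes gpd: "groupoid K" "groupoid H" "groupoid G" "groupoid L"
    and a: "a \<in> hom (biset_cat G L) X X'" and b: "b \<in> hom (biset_cat H G) Y Y'"
    and c: "c \<in> hom (biset_cat K H) Z Z'"
  shows "Comp (biset_cat K L) (associator K H G L X' Y' Z')
      (tensor_map K G L a (tensor_map K H G b c)) =
    Comp (biset_cat K L) (tensor_map K H L (tensor_map H G L a b) c) (associator K H G L X Y Z)"
proof -
  interpret ab: tensor_maps H G L X X' Y Y' a b using gpd a b by (intro tensor_mapsI)
  interpret bc: tensor_maps K H G Y Y' Z Z' b c using gpd b c by (intro tensor_mapsI)
  interpret a_bc: tensor_maps K G L X X' "tensor K H G Y Z" "tensor K H G Y' Z'" a "tensor_map K H G b c"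
    using gpd a by (intro tensor_mapsI bc.tensor_map_in_hom)
  interpret ab_c: tensor_maps K H L "tensor H G L X Y" "tensor H G L X' Y'" Z Z' "tensor_map H G L a b" c
    using gpd c by (intro tensor_mapsI ab.tensor_map_in_hom)
  interpret s: biset_triple K H G L X Y Z ..
  interpret t: biset_triple K H G L X' Y' Z' ..
  note Comp = app_Comp[OF gpd(1,4) a_bc.tensor_map_in_hom t.associator_in_hom]
    app_Comp[OF gpd(1,4) s.associator_in_hom ab_c.tensor_map_in_hom]
  show ?thesis
  proof (rule biset_map_eqI[OF gpd(1,4) Comp_in_hom[OF gpd(1,4) a_bc.tensor_map_in_hom t.associator_in_hom]
        Comp_in_hom[OF gpd(1,4) s.associator_in_hom ab_c.tensor_map_in_hom]])
    fix \<kappa> \<zeta> w assume k: "\<kappa> \<in> Obj K" "\<zeta> \<in> Obj L"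
      and w: "w \<in> Fobj (tensor K G L X (tensor K H G Y Z)) (\<kappa>, \<zeta>)"
    show "app (Comp (biset_cat K L) (associator K H G L X' Y' Z')
          (tensor_map K G L a (tensor_map K H G b c))) \<kappa> \<zeta> w =
        app (Comp (biset_cat K L) (tensor_map K H L (tensor_map H G L a b) c)
          (associator K H G L X Y Z)) \<kappa> \<zeta> w"
      using k by (cases rule: s.X_YZ_cases[OF w k])
        (simp add: Comp s.app_associator t.app_associator ab.app_tensor_map bc.app_tensor_map
          a_bc.app_tensor_map ab_c.app_tensor_map)
  qed
qed

text \<open>Either way round, \<open>[w, [x, [y, z]]]\<close> ends at
  \<open>[[[w, x], y], z]\<close>. Each associator in the diagram gets its own interpretation, since
  each brackets a different triple.\<close>

lemma associator_pentagon:
  assumes gpd: "groupoid J" "groupoid K" "groupoid H" "groupoid G" "groupoid L"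
    and adm: "admissible G L W" "admissible H G X" "admissible K H Y" "admissible J K Z"
  shows "Comp (biset_cat J L) (associator J K H L (tensor H G L W X) Y Z)
      (associator J H G L W X (tensor J K H Y Z)) =
    Comp (biset_cat J L) (tensor_map J K L (associator K H G L W X Y) (Ide (biset_cat J K) Z))
      (Comp (biset_cat J L) (associator J K G L W (tensor K H G X Y) Z)
        (tensor_map J G L (Ide (biset_cat G L) W) (associator J K H G X Y Z)))"
proof -
  interpret WXY: biset_triple K H G L W X Y using gpd adm by (intro biset_tripleI)
  interpret XYZ: biset_triple J K H G X Y Z using gpd adm by (intro biset_tripleI)
  interpret p1: biset_triple J H G L W X "tensor J K H Y Z" ..
  interpret p2: biset_triple J K H L "tensor H G L W X" Y Z ..
  interpret p3: biset_triple J K G L W "tensor K H G X Y" Z ..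
  interpret l: tensor_maps J G L W W "tensor J H G X (tensor J K H Y Z)"
    "tensor J K G (tensor K H G X Y) Z" "Ide (biset_cat G L) W" "associator J K H G X Y Z"
    using gpd adm by (intro tensor_mapsI Ide_in_hom XYZ.associator_in_hom)
  interpret r: tensor_maps J K L "tensor K G L W (tensor K H G X Y)" "tensor K H L (tensor H G L W X) Y"
    Z Z "associator K H G L W X Y" "Ide (biset_cat J K) Z"
    using gpd adm by (intro tensor_mapsI Ide_in_hom WXY.associator_in_hom)
  note h1 = p1.associator_in_hom p2.associator_in_hom
  note h2 = l.tensor_map_in_hom p3.associator_in_hom
  note h3 = Comp_in_hom[OF gpd(1,5) h2] r.tensor_map_in_hom
  note Comp = app_Comp[OF gpd(1,5) h1] app_Comp[OF gpd(1,5) h2] app_Comp[OF gpd(1,5) h3]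
  show ?thesis
  proof (rule biset_map_eqI[OF gpd(1,5) Comp_in_hom[OF gpd(1,5) h1] Comp_in_hom[OF gpd(1,5) h3]])
    fix \<kappa> \<zeta> v assume k: "\<kappa> \<in> Obj J" "\<zeta> \<in> Obj L"
      and v: "v \<in> Fobj (tensor J G L W (tensor J H G X (tensor J K H Y Z))) (\<kappa>, \<zeta>)"
    obtain \<gamma> \<eta> w x u where w: "\<gamma> \<in> Obj G" "\<eta> \<in> Obj H" "w \<in> Fobj W (\<gamma>, \<zeta>)" "x \<in> Fobj X (\<eta>, \<gamma>)"
        "u \<in> Fobj (tensor J K H Y Z) (\<kappa>, \<eta>)"
      and v: "v = bracket J G L W (tensor J H G X (tensor J K H Y Z)) \<kappa> \<zeta>
        (\<gamma>, w, bracket J H G X (tensor J K H Y Z) \<kappa> \<gamma> (\<eta>, x, u))"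
      using p1.X_YZ_cases[OF v k] .
    \<comment> \<open>\<open>p1\<close> treats \<open>Y \<otimes> Z\<close> as one factor, so the
      entry \<open>u\<close> still has to be split.\<close>
    obtain \<xi> y z where "\<xi> \<in> Obj K" "y \<in> Fobj Y (\<xi>, \<eta>)" "z \<in> Fobj Z (\<kappa>, \<xi>)"
      and "u = bracket J K H Y Z \<kappa> \<eta> (\<xi>, y, z)"
      using XYZ.YZ.bracket_cases[OF w(5) k(1) w(2)] .
    then show "app (Comp (biset_cat J L) (associator J K H L (tensor H G L W X) Y Z)
          (associator J H G L W X (tensor J K H Y Z))) \<kappa> \<zeta> v =
        app (Comp (biset_cat J L) (tensor_map J K L (associator K H G L W X Y) (Ide (biset_cat J K) Z))
          (Comp (biset_cat J L) (associator J K G L W (tensor K H G X Y) Z)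
            (tensor_map J G L (Ide (biset_cat G L) W) (associator J K H G X Y Z)))) \<kappa> \<zeta> v"
      using k w(1-4)
      by (simp add: v Comp WXY.app_associator XYZ.app_associator p1.app_associator p2.app_associator
          p3.app_associator l.app_tensor_map r.app_tensor_map)
  qed
qed

text \<open>On \<open>[x, [h, y]]\<close> the two sides give \<open>[xh, y]\<close> and
  \<open>[x, hy]\<close>, which the defining relation of the co-end identifies. Unlike the pentagon,
  the law thus needs a slide besides evaluation.\<close>

lemma unitor_triangle:
  assumes gpd: "groupoid K" "groupoid H" "groupoid G"
    and adm: "admissible H G X" "admissible K H Y"
  shows "Comp (biset_cat K G) (tensor_map K H G (right_unitor H G X) (Ide (biset_cat K H) Y))
      (associator K H H G X (unit_biset H) Y) =
    tensor_map K H G (Ide (biset_cat H G) X) (left_unitor K H Y)"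
proof -
  interpret biset_triple K H H G X "unit_biset H" Y
    using gpd adm by (intro biset_tripleI admissible_unit_biset)
  interpret X: unitors H G X ..
  interpret Y: unitors K H Y ..
  interpret r: tensor_maps K H G "tensor H H G X (unit_biset H)" X Y Y "right_unitor H G X" "Ide (biset_cat K H) Y"
    using gpd adm by (intro tensor_mapsI Ide_in_hom X.right_unitor_in_hom)
  interpret l: tensor_maps K H G X X "tensor K H H (unit_biset H) Y" Y "Ide (biset_cat H G) X" "left_unitor K H Y"
    using gpd adm by (intro tensor_mapsI Ide_in_hom Y.left_unitor_in_hom)
  note homs = associator_in_hom r.tensor_map_in_hom
  show ?thesis
  proof (rule biset_map_eqI[OF gpd(1,3) Comp_in_hom[OF gpd(1,3) homs] l.tensor_map_in_hom])
    fix \<kappa> \<gamma> v assume k: "\<kappa> \<in> Obj K" "\<gamma> \<in> Obj G"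
      and v: "v \<in> Fobj (tensor K H G X (tensor K H H (unit_biset H) Y)) (\<kappa>, \<gamma>)"
    obtain \<eta>' \<eta> x h y where x: "\<eta>' \<in> Obj H" "\<eta> \<in> Obj H" "x \<in> Fobj X (\<eta>', \<gamma>)"
        "h \<in> Fobj (unit_biset H) (\<eta>, \<eta>')" "y \<in> Fobj Y (\<kappa>, \<eta>)"
      and v: "v = bracket K H G X (tensor K H H (unit_biset H) Y) \<kappa> \<gamma>
        (\<eta>', x, bracket K H H (unit_biset H) Y \<kappa> \<eta>' (\<eta>, h, y))"
      using X_YZ_cases[OF v k] .
    then have h: "h \<in> Arr H" "Dom H h = \<eta>" "Cod H h = \<eta>'" by simp_all
    show "app (Comp (biset_cat K G) (tensor_map K H G (right_unitor H G X) (Ide (biset_cat K H) Y))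
          (associator K H H G X (unit_biset H) Y)) \<kappa> \<gamma> v =
        app (tensor_map K H G (Ide (biset_cat H G) X) (left_unitor K H Y)) \<kappa> \<gamma> v"
      using k x(1-3,5) h r.cod.bracket_slide[of \<kappa> \<gamma> h x y]
      by (simp add: v app_Comp[OF gpd(1,3) homs] app_associator l.app_tensor_map r.app_tensor_map)
  qed
qed

section \<open>Assembly of the bicategory\<close>

lemma biset_bicategory_simps [simp]:
  "Ob0 biset_bicategory = small_groupoids"
  "Hom biset_bicategory = biset_cat"
  "Unit biset_bicategory = unit_biset"
  "Assoc biset_bicategory = associator"
  "RUnit biset_bicategory = right_unitor"
  "LUnit biset_bicategory = left_unitor"
  by (simp_all add: biset_bicategory_def)

lemma hcomp1_biset_bicategory [simp]:
  "\<lbrakk>admissible H G X; admissible K H Y\<rbrakk> \<Longrightarrow> hcomp1 biset_bicategory K H G X Y = tensor K H G X Y"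
  by (simp add: biset_bicategory_def)

text \<open>The end points of \<open>a\<close> and \<open>b\<close> occur only in the premises, so
  uses of this rule supply the hom-set memberships explicitly.\<close>

lemma hcomp2_biset_bicategory:
  "\<lbrakk>a \<in> hom (biset_cat H G) X X'; b \<in> hom (biset_cat K H) Y Y'\<rbrakk> \<Longrightarrow>
    hcomp2 biset_bicategory K H G a b = tensor_map K H G a b"
  by (simp add: biset_bicategory_def hom_def)

lemma HComp_is_functor:
  assumes gpd: "groupoid K" "groupoid H" "groupoid G"
  shows "is_functor (prod_cat (biset_cat H G) (biset_cat K H)) (biset_cat K G)
    (HComp biset_bicategory K H G)"
proof -
  interpret A: groupoid "biset_cat H G" by (intro groupoid_biset_cat gpd)
  interpret B: groupoid "biset_cat K H" by (intro groupoid_biset_cat gpd)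
  let ?F = "HComp biset_bicategory K H G"
  have obj: "admissible K G (tensor K H G X Y)" if "admissible H G X" "admissible K H Y" for X Y
    using biset_pair.admissible_tensor biset_pairI that gpd by blast
  have arr: "tensor_map K H G a b \<in> hom (biset_cat K G)
      (tensor K H G (src a) (src b)) (tensor K H G (trg a) (trg b))"
    if "a \<in> Arr (biset_cat H G)" "b \<in> Arr (biset_cat K H)" for a b
    using that gpd by (intro tensor_maps.tensor_map_in_hom tensor_mapsI) (simp_all add: hom_def)
  have adm: "admissible H G (src a)" "admissible H G (trg a)" if "a \<in> Arr (biset_cat H G)"
    for a and H G :: "'a gpd"
    using that by (simp_all add: biset_cat_def)
  show ?thesis
    unfolding is_functor_def
  proof (intro conjI ballI impI)
    show "Fobj ?F \<in> Obj (prod_cat (biset_cat H G) (biset_cat K H)) \<rightarrow>\<^sub>E Obj (biset_cat K G)"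
      using obj by (auto simp: biset_bicategory_def)
    show "Farr ?F \<in> Arr (prod_cat (biset_cat H G) (biset_cat K H)) \<rightarrow>\<^sub>E Arr (biset_cat K G)"
      using arr by (auto simp: biset_bicategory_def hom_def)
  next
    fix f assume "f \<in> Arr (prod_cat (biset_cat H G) (biset_cat K H))"
    then show "Dom (biset_cat K G) (Farr ?F f) = Fobj ?F (Dom (prod_cat (biset_cat H G) (biset_cat K H)) f)"
      and "Cod (biset_cat K G) (Farr ?F f) = Fobj ?F (Cod (prod_cat (biset_cat H G) (biset_cat K H)) f)"
      using arr adm by (auto simp: biset_bicategory_def hom_def)
  next
    fix p assume "p \<in> Obj (prod_cat (biset_cat H G) (biset_cat K H))"
    then show "Farr ?F (Ide (prod_cat (biset_cat H G) (biset_cat K H)) p) = Ide (biset_cat K G) (Fobj ?F p)"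
      using gpd by (auto simp: biset_bicategory_def tensor_map_Ide)
  next
    fix f g assume "f \<in> Arr (prod_cat (biset_cat H G) (biset_cat K H))"
      "g \<in> Arr (prod_cat (biset_cat H G) (biset_cat K H))"
      "Cod (prod_cat (biset_cat H G) (biset_cat K H)) f = Dom (prod_cat (biset_cat H G) (biset_cat K H)) g"
    then obtain a b a' b' where f: "f = (a, b)" "g = (a', b')"
      and a: "a \<in> Arr (biset_cat H G)" "a' \<in> Arr (biset_cat H G)" "trg a = src a'"
      and b: "b \<in> Arr (biset_cat K H)" "b' \<in> Arr (biset_cat K H)" "trg b = src b'"
      by (cases f; cases g) auto
    have "tensor_map K H G (Comp (biset_cat H G) a' a) (Comp (biset_cat K H) b' b) =
        Comp (biset_cat K G) (tensor_map K H G a' b') (tensor_map K H G a b)"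
      using a b by (intro tensor_map_Comp[OF gpd, where X = "src a" and X' = "trg a" and X'' = "trg a'"
            and Y = "src b" and Y' = "trg b" and Y'' = "trg b'"]) (simp_all add: hom_def)
    then show "Farr ?F (Comp (prod_cat (biset_cat H G) (biset_cat K H)) g f) =
        Comp (biset_cat K G) (Farr ?F g) (Farr ?F f)"
      using a b by (simp add: f biset_bicategory_def)
  qed
qed

text \<open>Once \<open>hcomp1\<close> and \<open>hcomp2\<close> are rewritten to
  \<open>tensor\<close> and \<open>tensor_map\<close>, the axioms are the preceding lemmas. The
  rewriting is conditional, and the facts collected first give the typing of each factor that it
  asks for.\<close>

lemma bicategory_biset_bicategory: "bicategory biset_bicategory"
proof (rule bicategory.intro)
  have gpd: "groupoid G" if "G \<in> Ob0 biset_bicategory" for G :: "'a gpd"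
    using that by (simp add: small_groupoids_def)
  have dom: "admissible H G X" and cod: "admissible H G X'" if "a \<in> hom (biset_cat H G) X X'"
    for a X X' and H G :: "'a gpd"
    using that by (auto simp: hom_def biset_cat_def)
  have tens: "admissible K G (tensor K H G X Y)"
    if "groupoid K" "groupoid H" "groupoid G" "admissible H G X" "admissible K H Y"
    for K H G :: "'a gpd" and X Y
    using biset_pair.admissible_tensor[OF biset_pairI] that by blast
  note unit = admissible_unit_biset
  note tensor_hom = tensor_maps.tensor_map_in_hom[OF tensor_mapsI]
  note assoc_hom = biset_triple.associator_in_hom[OF biset_tripleI]
  have unitors: "unitors H G X" if "groupoid H" "groupoid G" "admissible H G X"
    for H G :: "'a gpd" and X
    using that by (simp add: unitors_def admissible_bisetI)
  note runit_hom = unitors.right_unitor_in_hom[OF unitors]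
  note lunit_hom = unitors.left_unitor_in_hom[OF unitors]
  note hcomp2 = hcomp2_biset_bicategory
  show "category (Hom biset_bicategory H G)"
    if "H \<in> Ob0 biset_bicategory" "G \<in> Ob0 biset_bicategory" for H G :: "'a gpd"
    using groupoid.axioms(1)[OF groupoid_biset_cat[OF gpd[OF that(1)] gpd[OF that(2)]]] by simp
  show "is_functor (prod_cat (Hom biset_bicategory H G) (Hom biset_bicategory K H))
      (Hom biset_bicategory K G) (HComp biset_bicategory K H G)"
    if "K \<in> Ob0 biset_bicategory" "H \<in> Ob0 biset_bicategory" "G \<in> Ob0 biset_bicategory"
    for K H G :: "'a gpd"
    using HComp_is_functor[OF gpd[OF that(1)] gpd[OF that(2)] gpd[OF that(3)]] by simp
  show "Unit biset_bicategory G \<in> Obj (Hom biset_bicategory G G)"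
    if "G \<in> Ob0 biset_bicategory" for G :: "'a gpd"
    using unit gpd[OF that] by simp
  show "is_iso (Hom biset_bicategory K L)
      (hcomp1 biset_bicategory K G L X (hcomp1 biset_bicategory K H G Y Z))
      (hcomp1 biset_bicategory K H L (hcomp1 biset_bicategory H G L X Y) Z)
      (Assoc biset_bicategory K H G L X Y Z)"
    if "K \<in> Ob0 biset_bicategory" "H \<in> Ob0 biset_bicategory" "G \<in> Ob0 biset_bicategory"
      "L \<in> Ob0 biset_bicategory" "X \<in> Obj (Hom biset_bicategory G L)"
      "Y \<in> Obj (Hom biset_bicategory H G)" "Z \<in> Obj (Hom biset_bicategory K H)"
    for K H G L :: "'a gpd" and X Y Z
    using gpd[OF that(1)] gpd[OF that(2)] gpd[OF that(3)] gpd[OF that(4)] that(5-)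
    by (simp add: is_iso_biset_cat_iff tens assoc_hom)
  show "Comp (Hom biset_bicategory K L) (Assoc biset_bicategory K H G L X' Y' Z')
      (hcomp2 biset_bicategory K G L a (hcomp2 biset_bicategory K H G b c)) =
    Comp (Hom biset_bicategory K L) (hcomp2 biset_bicategory K H L (hcomp2 biset_bicategory H G L a b) c)
      (Assoc biset_bicategory K H G L X Y Z)"
    if o: "K \<in> Ob0 biset_bicategory" "H \<in> Ob0 biset_bicategory" "G \<in> Ob0 biset_bicategory"
      "L \<in> Ob0 biset_bicategory"
      and h: "a \<in> hom (Hom biset_bicategory G L) X X'" "b \<in> hom (Hom biset_bicategory H G) Y Y'"
      "c \<in> hom (Hom biset_bicategory K H) Z Z'"
    for K H G L :: "'a gpd" and a b c X Y Z X' Y' Z'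
  proof -
    note g = gpd[OF o(1)] gpd[OF o(2)] gpd[OF o(3)] gpd[OF o(4)]
    note h = h[unfolded biset_bicategory_simps]
    show ?thesis
      using associator_natural[OF g h]
      by (simp add: hcomp2[OF h(2,3)] hcomp2[OF h(1,2)]
          hcomp2[OF h(1) tensor_hom[OF g(1-3) h(2,3)]] hcomp2[OF tensor_hom[OF g(2-4) h(1,2)] h(3)])
  qed
  show "is_iso (Hom biset_bicategory H G) (hcomp1 biset_bicategory H H G X (Unit biset_bicategory H)) X
      (RUnit biset_bicategory H G X)"
    and "is_iso (Hom biset_bicategory H G) (hcomp1 biset_bicategory H G G (Unit biset_bicategory G) X) X
      (LUnit biset_bicategory H G X)"
    if "H \<in> Ob0 biset_bicategory" "G \<in> Ob0 biset_bicategory" "X \<in> Obj (Hom biset_bicategory H G)"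
    for H G :: "'a gpd" and X
    using gpd[OF that(1)] gpd[OF that(2)] that(3)
    by (simp_all add: is_iso_biset_cat_iff unit runit_hom lunit_hom)
  show "Comp (Hom biset_bicategory H G) (RUnit biset_bicategory H G X')
      (hcomp2 biset_bicategory H H G a (Ide (Hom biset_bicategory H H) (Unit biset_bicategory H))) =
    Comp (Hom biset_bicategory H G) a (RUnit biset_bicategory H G X)"
    and "Comp (Hom biset_bicategory H G) (LUnit biset_bicategory H G X')
      (hcomp2 biset_bicategory H G G (Ide (Hom biset_bicategory G G) (Unit biset_bicategory G)) a) =
    Comp (Hom biset_bicategory H G) a (LUnit biset_bicategory H G X)"
    if o: "H \<in> Ob0 biset_bicategory" "G \<in> Ob0 biset_bicategory"
      and a: "a \<in> hom (Hom biset_bicategory H G) X X'"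
    for H G :: "'a gpd" and a X X'
  proof -
    note g = gpd[OF o(1)] gpd[OF o(2)]
    note a = a[unfolded biset_bicategory_simps]
    note i = Ide_in_hom[OF g(1,1) unit[OF g(1)]] Ide_in_hom[OF g(2,2) unit[OF g(2)]]
    show "Comp (Hom biset_bicategory H G) (RUnit biset_bicategory H G X')
        (hcomp2 biset_bicategory H H G a (Ide (Hom biset_bicategory H H) (Unit biset_bicategory H))) =
      Comp (Hom biset_bicategory H G) a (RUnit biset_bicategory H G X)"
      using right_unitor_natural[OF g a] by (simp add: hcomp2[OF a i(1)])
    show "Comp (Hom biset_bicategory H G) (LUnit biset_bicategory H G X')
        (hcomp2 biset_bicategory H G G (Ide (Hom biset_bicategory G G) (Unit biset_bicategory G)) a) =
      Comp (Hom biset_bicategory H G) a (LUnit biset_bicategory H G X)"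
      using left_unitor_natural[OF g a] by (simp add: hcomp2[OF i(2) a])
  qed
  show "Comp (Hom biset_bicategory J L)
      (Assoc biset_bicategory J K H L (hcomp1 biset_bicategory H G L W X) Y Z)
      (Assoc biset_bicategory J H G L W X (hcomp1 biset_bicategory J K H Y Z)) =
    Comp (Hom biset_bicategory J L)
      (hcomp2 biset_bicategory J K L (Assoc biset_bicategory K H G L W X Y) (Ide (Hom biset_bicategory J K) Z))
      (Comp (Hom biset_bicategory J L)
        (Assoc biset_bicategory J K G L W (hcomp1 biset_bicategory K H G X Y) Z)
        (hcomp2 biset_bicategory J G L (Ide (Hom biset_bicategory G L) W) (Assoc biset_bicategory J K H G X Y Z)))"
    if o: "J \<in> Ob0 biset_bicategory" "K \<in> Ob0 biset_bicategory" "H \<in> Ob0 biset_bicategory"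
      "G \<in> Ob0 biset_bicategory" "L \<in> Ob0 biset_bicategory"
      and adm: "W \<in> Obj (Hom biset_bicategory G L)" "X \<in> Obj (Hom biset_bicategory H G)"
      "Y \<in> Obj (Hom biset_bicategory K H)" "Z \<in> Obj (Hom biset_bicategory J K)"
    for J K H G L :: "'a gpd" and W X Y Z
  proof -
    note g = gpd[OF o(1)] gpd[OF o(2)] gpd[OF o(3)] gpd[OF o(4)] gpd[OF o(5)]
    note adm = adm[unfolded biset_bicategory_simps biset_cat_simps]
    show ?thesis
      using associator_pentagon[OF g adm] adm
      by (simp add: hcomp2[OF assoc_hom[OF g(2-5) adm(1-3)] Ide_in_hom[OF g(1,2) adm(4)]]
          hcomp2[OF Ide_in_hom[OF g(4,5) adm(1)] assoc_hom[OF g(1-4) adm(2-4)]])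
  qed
  show "Comp (Hom biset_bicategory K G)
      (hcomp2 biset_bicategory K H G (RUnit biset_bicategory H G X) (Ide (Hom biset_bicategory K H) Y))
      (Assoc biset_bicategory K H H G X (Unit biset_bicategory H) Y) =
    hcomp2 biset_bicategory K H G (Ide (Hom biset_bicategory H G) X) (LUnit biset_bicategory K H Y)"
    if o: "K \<in> Ob0 biset_bicategory" "H \<in> Ob0 biset_bicategory" "G \<in> Ob0 biset_bicategory"
      and adm: "X \<in> Obj (Hom biset_bicategory H G)" "Y \<in> Obj (Hom biset_bicategory K H)"
    for K H G :: "'a gpd" and X Y
  proof -
    note g = gpd[OF o(1)] gpd[OF o(2)] gpd[OF o(3)]
    note adm = adm[unfolded biset_bicategory_simps biset_cat_simps]
    show ?thesis
      using unitor_triangle[OF g adm]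
      by (simp add: hcomp2[OF runit_hom[OF g(2,3) adm(1)] Ide_in_hom[OF g(1,2) adm(2)]]
          hcomp2[OF Ide_in_hom[OF g(2,3) adm(1)] lunit_hom[OF g(1,2) adm(2)]])
  qed
qed

text \<open>The bicategory axioms alone would not show that the description operator in
  \<open>coend_map\<close> returns the intended values. The remaining conjuncts pin the data down:
  the hom-categories are groupoids, tensor products are admissible, and actions, tensor products of
  2-cells, unitors and associators have the prescribed values on brackets.\<close>

theorem mainTheorem3:
  shows "bicategory (biset_bicategory ::
        ('u::infinite gpd, 'u biset, 'u biset_map) bicategory_data)
    \<and> (\<forall>(H :: 'u gpd) \<in> small_groupoids. \<forall>G \<in> small_groupoids. groupoid (biset_cat H G))
    \<and> (\<forall>(K :: 'u gpd) \<in> small_groupoids. \<forall>H \<in> small_groupoids. \<forall>G \<in> small_groupoids.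
        \<forall>X Y. admissible H G X \<longrightarrow> admissible K H Y \<longrightarrow>
          admissible K G (tensor K H G X Y)
        \<and> (\<forall>k \<in> Arr K. \<forall>g \<in> Arr G. \<forall>\<eta> \<in> Obj H.
            \<forall>x \<in> Fobj X (\<eta>, Dom G g). \<forall>y \<in> Fobj Y (Cod K k, \<eta>).
              act (tensor K H G X Y) (k, g) (bracket K H G X Y (Cod K k) (Dom G g) (\<eta>, x, y)) =
              bracket K H G X Y (Dom K k) (Cod G g)
                (\<eta>, act X (Ide H \<eta>, g) x, act Y (k, Ide H \<eta>) y)))
    \<and> (\<forall>(K :: 'u gpd) \<in> small_groupoids. \<forall>H \<in> small_groupoids. \<forall>G \<in> small_groupoids.
        \<forall>a \<in> Arr (biset_cat H G). \<forall>b \<in> Arr (biset_cat K H).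
        \<forall>\<kappa> \<in> Obj K. \<forall>\<eta> \<in> Obj H. \<forall>\<gamma> \<in> Obj G.
        \<forall>x \<in> Fobj (src a) (\<eta>, \<gamma>). \<forall>y \<in> Fobj (src b) (\<kappa>, \<eta>).
          amap (amap (tensor_map K H G a b) (\<kappa>, \<gamma>))
            (bracket K H G (src a) (src b) \<kappa> \<gamma> (\<eta>, x, y)) =
          bracket K H G (trg a) (trg b) \<kappa> \<gamma>
            (\<eta>, amap (amap a (\<eta>, \<gamma>)) x, amap (amap b (\<kappa>, \<eta>)) y))
    \<and> (\<forall>(H :: 'u gpd) \<in> small_groupoids. \<forall>G \<in> small_groupoids. \<forall>X. admissible H G X \<longrightarrow>
        (\<forall>\<gamma> \<in> Obj G. \<forall>h \<in> Arr H. \<forall>x \<in> Fobj X (Cod H h, \<gamma>).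
          amap (amap (right_unitor H G X) (Dom H h, \<gamma>))
            (bracket H H G X (unit_biset H) (Dom H h) \<gamma> (Cod H h, x, h)) =
          act X (h, Ide G \<gamma>) x))
    \<and> (\<forall>(H :: 'u gpd) \<in> small_groupoids. \<forall>G \<in> small_groupoids. \<forall>Y. admissible H G Y \<longrightarrow>
        (\<forall>\<eta> \<in> Obj H. \<forall>g \<in> Arr G. \<forall>y \<in> Fobj Y (\<eta>, Dom G g).
          amap (amap (left_unitor H G Y) (\<eta>, Cod G g))
            (bracket H G G (unit_biset G) Y \<eta> (Cod G g) (Dom G g, g, y)) =
          act Y (Ide H \<eta>, g) y))
    \<and> (\<forall>(K :: 'u gpd) \<in> small_groupoids. \<forall>H \<in> small_groupoids.
        \<forall>G \<in> small_groupoids. \<forall>L \<in> small_groupoids.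
        \<forall>X Y Z. admissible G L X \<longrightarrow> admissible H G Y \<longrightarrow> admissible K H Z \<longrightarrow>
        (\<forall>\<kappa> \<in> Obj K. \<forall>\<eta> \<in> Obj H. \<forall>\<gamma> \<in> Obj G. \<forall>\<zeta> \<in> Obj L.
         \<forall>x \<in> Fobj X (\<gamma>, \<zeta>). \<forall>y \<in> Fobj Y (\<eta>, \<gamma>). \<forall>z \<in> Fobj Z (\<kappa>, \<eta>).
          amap (amap (associator K H G L X Y Z) (\<kappa>, \<zeta>))
            (bracket K G L X (tensor K H G Y Z) \<kappa> \<zeta> (\<gamma>, x, bracket K H G Y Z \<kappa> \<gamma> (\<eta>, y, z))) =
          bracket K H L (tensor H G L X Y) Z \<kappa> \<zeta> (\<eta>, bracket H G L X Y \<eta> \<zeta> (\<gamma>, x, y), z)))"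
proof (intro conjI ballI allI impI)
  show "bicategory (biset_bicategory :: ('u gpd, 'u biset, 'u biset_map) bicategory_data)"
    by (rule bicategory_biset_bicategory)
\<comment> \<open>The introduction rules enter the locales from the admissibility hypotheses.
  \<open>category.Dom_in\<close> and \<open>category.Cod_in\<close> provide the objects where the
  statement quantifies over arrows.\<close>
qed (auto simp: small_groupoids_def hom_def
  intro!: groupoid_biset_cat biset_pair.admissible_tensor biset_pair.act_tensor biset_pairI
    tensor_maps.app_tensor_map tensor_mapsI unitors.app_right_unitor unitors.app_left_unitor
    biset_triple.app_associator biset_tripleI unitors.intro admissible_bisetI
    category.Dom_in category.Cod_in groupoid.axioms(1))

end
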